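(* Let $d\ge 2$ and let $M\in GL(d,\mathbb{Z})$ be a matrix of infinite order. Then there exists $n_0$ such that, for all $n\ge n_0$, the matrix $M^n$ is not conjugate in $GL(d,\mathbb{Z})$ to a companion matrix.
   Context: A companion matrix is a $d\times d$ integer matrix whose subdiagonal entries (positions $(i+1,i)$, $1\le i\le d-1$) are all equal to $1$, whose last column consists of arbitrary integers, and all of whose other entries are $0$. *)

theory Defs
  imports "Jordan_Normal_Form.Matrix"
begin

definition GL_int :: "nat \<Rightarrow> int mat set" where
  "GL_int d = {M \<in> carrier_mat d d. invertible_mat M}"

definition infinite_order_mat :: "int mat \<Rightarrow> bool" where
  "infinite_order_mat M \<longleftrightarrow> (\<forall>k>0. M ^\<^sub>m k \<noteq> 1\<^sub>m (dim_row M))"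

text \<open>Matrix indices start at 0, so the last column is column \<open>d - 1\<close>; it is unconstrained.\<close>

definition companion_mat :: "nat \<Rightarrow> int mat \<Rightarrow> bool" where
  "companion_mat d C \<longleftrightarrow> C \<in> carrier_mat d d \<and>
     (\<forall>i<d. \<forall>j<d - 1. C $$ (i, j) = (if i = j + 1 then 1 else 0))"

text \<open>Since \<^const>\<open>similar_mat\<close> asks for mutually inverse matrices over the coefficient ring,
  at type \<^typ>\<open>int mat\<close> it is conjugacy by an element of \<open>GL(d,\<int>)\<close>.\<close>

definition conjugate_to_companion :: "nat \<Rightarrow> int mat \<Rightarrow> bool" where
  "conjugate_to_companion d A \<longleftrightarrow> (\<exists>C. companion_mat d C \<and> similar_mat A C)"

end

theory Submission
  imports
    "HOL-Analysis.Kronecker_Approximation_Theorem"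
    Defs
    "Jordan_Normal_Form.Char_Poly"
begin

text \<open>
  Suppose that \<open>M\<^sup>n\<close> is conjugate to a companion matrix for infinitely many \<open>n\<close>. Choosing one such
  \<open>m \<ge> 2\<close> and changing basis, let \<open>A\<close> be conjugate to \<open>M\<close> with \<open>A\<^sup>m\<close> a companion matrix, and let
  \<open>v\<close> be the first basis vector. If \<open>A\<^sup>n\<close> is conjugate to a companion matrix, then its centralizer is
  \<open>\<int>[A\<^sup>n]\<close>, so the powers of \<open>A\<^sup>m\<close> are polynomials in \<open>A\<^sup>n\<close> and \<open>v, A\<^sup>n v, A\<^sup>2\<^sup>n v, \<dots>\<close> is a basis:
  the integer \<open>u(n) = det (v, A\<^sup>n v, \<dots>, A\<^bsup>(d-1)n\<^esup> v)\<close> is \<open>\<plusminus>1\<close>.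

  The eigenvalues of \<open>A\<close> are distinct, because a multiple root \<open>\<mu>\<close> of the characteristic polynomial of
  \<open>A\<^sup>m\<close> would make \<open>1/m\<close> an algebraic integer. Hence \<open>u(n)\<close> is, up to a constant, the Vandermonde
  product of the differences \<open>\<kappa>\<^sub>i\<^sup>n - \<kappa>\<^sub>j\<^sup>n\<close> of powers of the eigenvalues.

  By Skolem's 2-adic method \<open>u = \<plusminus>1\<close> infinitely often forces \<open>u\<close> to be constant on an arithmetic
  progression. As \<open>A\<close> has infinite order, some eigenvalue is off the unit circle while the product of
  all of them has modulus 1. Along a subsequence of the progression on which the arguments of all
  eigenvalues recur, the Vandermonde product tends to infinity, a contradiction.
\<close>

section \<open>Sequences with 2-adically small differences\<close>

definition fdiff :: "(nat \<Rightarrow> int) \<Rightarrow> nat \<Rightarrow> int" where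
  "fdiff f = (\<lambda>k. f (Suc k) - f k)"

text \<open>Since \<open>4 ^ m / m!\<close> tends to 0 in the 2-adic numbers, the Newton series of such a sequence
  converges to a 2-adic analytic function.\<close>

definition flat :: "(nat \<Rightarrow> int) \<Rightarrow> bool" where
  "flat f \<longleftrightarrow> (\<forall>m k. 4 ^ m dvd (fdiff ^^ m) f k)"

lemma fdiff_pow_Suc: "(fdiff ^^ Suc m) f = (fdiff ^^ m) (fdiff f)"
  by (simp add: funpow_swap1)

lemma fdiff_pow_add: "(fdiff ^^ m) (\<lambda>k. f k + g k) = (\<lambda>k. (fdiff ^^ m) f k + (fdiff ^^ m) g k)"
  by (induction m) (auto simp: fdiff_def)

lemma fdiff_pow_cmult: "(fdiff ^^ m) (\<lambda>k. c * f k) = (\<lambda>k. c * (fdiff ^^ m) f k)"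
  by (induction m) (auto simp: fdiff_def algebra_simps)

lemma fdiff_pow_shift: "(fdiff ^^ m) (\<lambda>k. f (Suc k)) = (\<lambda>k. (fdiff ^^ m) f (Suc k))"
  by (induction m) (auto simp: fdiff_def)

lemma fdiff_const: "fdiff (\<lambda>k. c) = (\<lambda>k. 0)"
  by (simp add: fdiff_def)

lemma fdiff_pow_zero: "(fdiff ^^ m) (\<lambda>k. 0) = (\<lambda>k. 0)"
  by (induction m) (auto simp: fdiff_def)

lemma flat_const: "flat (\<lambda>k. c)"
  unfolding flat_def
proof (intro allI)
  fix m k show "4 ^ m dvd (fdiff ^^ m) (\<lambda>k. c) k"
    by (cases m) (auto simp: fdiff_pow_Suc fdiff_const fdiff_pow_zero simp del: funpow.simps(2))
qed

lemma flat_add: "flat f \<Longrightarrow> flat g \<Longrightarrow> flat (\<lambda>k. f k + g k)"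
  unfolding flat_def by (auto simp: fdiff_pow_add)

lemma flat_sum: "(\<And>x. x \<in> I \<Longrightarrow> flat (f x)) \<Longrightarrow> flat (\<lambda>k. \<Sum>x\<in>I. f x k)"
  by (induction I rule: infinite_finite_induct) (auto simp: flat_const flat_add)

lemma fdiff_mult: "fdiff (\<lambda>k. f k * g k) = (\<lambda>k. fdiff f k * g k + f (Suc k) * fdiff g k)"
  by (auto simp: fdiff_def algebra_simps)

text \<open>The discrete Leibniz rule \<open>fdiff_mult\<close> gives two products, each with one
  factor differenced. Differencing raises the offset \<open>a\<close> or \<open>b\<close> of that
  factor by one, which is why the induction carries general offsets.\<close>

lemma fdiff_pow_mult_dvd:
  assumes "\<And>i k. 4 ^ (a + i) dvd (fdiff ^^ i) f k" and "\<And>i k. 4 ^ (b + i) dvd (fdiff ^^ i) g k"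
  shows "4 ^ (a + b + m) dvd (fdiff ^^ m) (\<lambda>k. f k * g k) k"
  using assms
proof (induction m arbitrary: f g a b k)
  case 0
  from 0(1)[of 0 k] 0(2)[of 0 k] show ?case by (simp add: power_add mult_dvd_mono)
next
  case (Suc m)
  have f': "4 ^ (Suc a + i) dvd (fdiff ^^ i) (fdiff f) k" for i k
    using Suc.prems(1)[of "Suc i" k] by (simp add: fdiff_pow_Suc del: funpow.simps(2))
  have g': "4 ^ (Suc b + i) dvd (fdiff ^^ i) (fdiff g) k" for i k
    using Suc.prems(2)[of "Suc i" k] by (simp add: fdiff_pow_Suc del: funpow.simps(2))
  have fs: "4 ^ (a + i) dvd (fdiff ^^ i) (\<lambda>k. f (Suc k)) k" for i k
    using Suc.prems(1) by (simp add: fdiff_pow_shift)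
  from Suc.IH[OF f' Suc.prems(2)] Suc.IH[OF fs g'] show ?case
    by (simp add: fdiff_pow_Suc fdiff_mult fdiff_pow_add del: funpow.simps(2))
qed

lemma flat_mult: "flat f \<Longrightarrow> flat g \<Longrightarrow> flat (\<lambda>k. f k * g k)"
  using fdiff_pow_mult_dvd[of 0 f 0 g] unfolding flat_def by simp

lemma flat_prod: "(\<And>x. x \<in> I \<Longrightarrow> flat (f x)) \<Longrightarrow> flat (\<lambda>k. \<Prod>x\<in>I. f x k)"
  by (induction I rule: infinite_finite_induct) (auto simp: flat_const flat_mult)

text \<open>Newton's forward difference formula: the induction hypothesis is applied to both
  \<open>f\<close> and \<open>fdiff f\<close>, and Pascal's rule merges the two sums.\<close>

lemma newton_forward:
  fixes f :: "nat \<Rightarrow> int"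
  shows "f k = (\<Sum>j\<le>k. int (k choose j) * (fdiff ^^ j) f 0)"
proof (induction k arbitrary: f)
  case (Suc k)
  have "f (Suc k) = f k + fdiff f k" by (simp add: fdiff_def)
  also have "f k = (\<Sum>j\<le>k. int (k choose j) * (fdiff ^^ j) f 0)" by (rule Suc.IH)
  also have "\<dots> = (\<Sum>j\<le>Suc k. int (k choose j) * (fdiff ^^ j) f 0)" by simp
  also have "\<dots> = f 0 + (\<Sum>j\<le>k. int (k choose Suc j) * (fdiff ^^ Suc j) f 0)"
    by (subst sum.atMost_Suc_shift) simp
  also have "fdiff f k = (\<Sum>j\<le>k. int (k choose j) * (fdiff ^^ Suc j) f 0)"
    unfolding fdiff_pow_Suc by (rule Suc.IH)
  finally have "f (Suc k) = f 0 + (\<Sum>j\<le>k. int (Suc k choose Suc j) * (fdiff ^^ Suc j) f 0)"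
    by (simp add: sum.distrib algebra_simps)
  also have "\<dots> = (\<Sum>j\<le>Suc k. int (Suc k choose j) * (fdiff ^^ j) f 0)"
    by (subst sum.atMost_Suc_shift) (simp del: binomial_Suc_Suc)
  finally show ?case .
qed simp

text \<open>The binomials with \<open>j > k\<close> vanish, so one upper limit \<open>K\<close>
  serves all arguments up to \<open>K\<close>, as interpolation by a single polynomial
  requires.\<close>

lemma newton_forward_le:
  fixes f :: "nat \<Rightarrow> int"
  assumes "k \<le> K"
  shows "f k = (\<Sum>j\<le>K. int (k choose j) * (fdiff ^^ j) f 0)"
proof -
  have "(\<Sum>j\<le>K. int (k choose j) * (fdiff ^^ j) f 0) = (\<Sum>j\<le>k. int (k choose j) * (fdiff ^^ j) f 0)"
    using assms by (intro sum.mono_neutral_right) auto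
  with newton_forward[of f k] show ?thesis by simp
qed

section \<open>Powers of 2 in factorials\<close>

lemma fact_double_odd: "\<exists>c::nat. odd c \<and> fact (2 * m) = 2 ^ m * fact m * c"
proof (induction m)
  case (Suc m)
  then obtain c :: nat where c: "odd c" "fact (2 * m) = 2 ^ m * fact m * c" by auto
  have "fact (2 * Suc m) = (2 * m + 2) * ((2 * m + 1) * fact (2 * m) :: nat)"
    by (simp add: algebra_simps)
  also have "\<dots> = 2 ^ Suc m * fact (Suc m) * ((2 * m + 1) * c)"
    unfolding c(2) by (simp add: algebra_simps)
  finally show ?case using c(1) by (intro exI[of _ "(2 * m + 1) * c"]) auto
qed auto

text \<open>The exponent of 2 in \<open>(2m)!\<close> is \<open>m\<close> plus the exponent in
  \<open>m!\<close>, hence at most \<open>2m\<close> by induction; an odd \<open>n\<close> only adds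
  an odd factor.\<close>

lemma fact_two_adic: "\<exists>e c::nat. e \<le> n \<and> odd c \<and> fact n = 2 ^ e * c"
proof (induction n rule: less_induct)
  case (less n)
  show ?case
  proof (cases "n = 0")
    case False
    define m where "m = n div 2"
    have "m < n" using False by (simp add: m_def)
    with less obtain e c :: nat where e: "e \<le> m" "odd c" "fact m = 2 ^ e * c" by blast
    obtain b :: nat where b: "odd b" "fact (2 * m) = 2 ^ m * fact m * b" using fact_double_odd by blast
    have ev: "fact (2 * m) = 2 ^ (m + e) * (c * b)" using b e by (simp add: power_add)
    show ?thesis
    proof (cases "even n")
      case True
      then have "n = 2 * m" by (simp add: m_def)
      then show ?thesis using ev e b by (intro exI[of _ "m + e"] exI[of _ "c * b"]) auto
    next
      case False
      then have n: "n = Suc (2 * m)" by (simp add: m_def)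
      have "fact n = 2 ^ (m + e) * (n * (c * b))" unfolding n fact_Suc ev by (simp add: algebra_simps)
      then show ?thesis using n e b False by (intro exI[of _ "m + e"] exI[of _ "n * (c * b)"]) auto
    qed
  qed (auto intro: exI[of _ 1])
qed

text \<open>\<open>L\<close> collects the odd parts of the factorials. Being odd, it clears the
  denominators of all \<open>2 ^ j / j!\<close> without affecting divisibility by powers of
  2.\<close>

lemma odd_multiple_fact_dvd: "\<exists>L::nat. odd L \<and> (\<forall>j\<le>K. fact j dvd L * 2 ^ j)"
proof (induction K)
  case (Suc K)
  then obtain L :: nat where L: "odd L" "\<forall>j\<le>K. fact j dvd L * 2 ^ j" by auto
  obtain e c :: nat where e: "e \<le> Suc K" "odd c" "fact (Suc K) = 2 ^ e * c" using fact_two_adic by blast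
  have "fact j dvd (L * c) * 2 ^ j" if "j \<le> Suc K" for j
  proof (cases "j = Suc K")
    case True
    have "2 ^ e * c dvd 2 ^ Suc K * (L * c)" using e(1) by (intro mult_dvd_mono le_imp_power_dvd) auto
    with True e(3) show ?thesis by (simp add: mult.commute)
  next
    case False
    with that L(2) have "fact j dvd L * 2 ^ j" by auto
    then have "fact j dvd (L * 2 ^ j) * c" by (rule dvd_mult2)
    then show ?thesis by (simp add: mult_ac)
  qed
  with L e show ?case by (intro exI[of _ "L * c"]) auto
qed (auto intro: exI[of _ 1])

lemma prod_diff_eq_fact_binomial:
  "(\<Prod>i<j. int k - int i) = fact j * int (k choose j)"
proof (induction j)
  case (Suc j)
  have "int (Suc j) * int (k choose Suc j) = (int k - int j) * int (k choose j)"
  proof (cases "j \<le> k")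
    case True
    have "Suc j * (k choose Suc j) = (k - j) * (k choose j)"
      by (metis binomial_absorb_comp binomial_absorption diff_Suc_1 mult.commute)
    then show ?thesis using True by (metis of_nat_diff of_nat_mult)
  qed (simp add: binomial_eq_0)
  then have "fact j * ((int k - int j) * int (k choose j)) = fact (Suc j) * int (k choose Suc j)"
    by (metis (no_types) fact_Suc mult.assoc mult.commute)
  with Suc show ?case by (simp add: mult_ac)
qed simp

section \<open>Division by monic integer polynomials\<close>

lemma monic_division:
  fixes D H :: "int poly"
  assumes "lead_coeff D = 1"
  obtains q r where "H = D * q + r" "degree r < degree D \<or> r = 0"
proof -
  have D0: "D \<noteq> 0" using assms by auto
  obtain q r where qr: "pseudo_divmod H D = (q, r)" by fastforce
  from pseudo_divmod[OF D0 qr] assms show ?thesis by (auto intro: that)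
qed

text \<open>Uniqueness of division by a monic polynomial: with \<open>q\<close> the quotient of
  \<open>H\<close> by \<open>D\<close>, the product \<open>D * (h - smult c q)\<close> is zero or of
  degree below that of \<open>D\<close>, so its second factor vanishes. The low-degree
  \<open>G\<close> only affects the remainder.\<close>

lemma monic_quotient_dvd:
  fixes D h H G :: "int poly"
  assumes D: "lead_coeff D = 1" and eq: "D * h = G + smult c H" and G: "degree G < degree D \<or> G = 0"
  shows "\<exists>q. h = smult c q"
proof -
  obtain q r where qr: "H = D * q + r" "degree r < degree D \<or> r = 0" using monic_division[OF D] by blast
  have "D * (h - smult c q) = G + smult c r"
    using eq qr(1) by (simp add: algebra_simps smult_add_right)
  moreover have "degree (G + smult c r) < degree D \<or> G + smult c r = 0"
    using G qr(2) by (metis add.left_neutral add.right_neutral degree_add_less degree_smult_le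
      le_less_trans smult_0_right)
  ultimately have "h - smult c q = 0"
    using D by (metis degree_mult_eq degree_0 leading_coeff_0_iff mult_eq_0_iff not_add_less1 zero_neq_one)
  then show ?thesis by auto
qed

text \<open>Roots are added one at a time: the cofactor \<open>h\<close> must vanish at the new
  \<open>z\<close>, because the earlier linear factors do not. All quotients stay integral.\<close>

lemma prod_linear_dvd:
  fixes G :: "int poly"
  assumes "finite Z" and "\<And>z. z \<in> Z \<Longrightarrow> poly G z = 0"
  shows "(\<Prod>z\<in>Z. [:- z, 1:]) dvd G"
  using assms
proof (induction Z)
  case (insert z Z)
  then obtain h where h: "G = (\<Prod>z\<in>Z. [:- z, 1:]) * h" by (auto elim: dvdE)
  have "(\<Prod>y\<in>Z. z - y) \<noteq> 0" using insert by auto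
  moreover have "(\<Prod>y\<in>Z. z - y) * poly h z = 0"
    using insert.prems[of z] unfolding h by (simp add: poly_prod)
  ultimately have "poly h z = 0" by simp
  then have "[:- z, 1:] dvd h" by (simp add: poly_eq_0_iff_dvd)
  then show ?case using insert.hyps h by (simp add: mult.commute mult_dvd_mono del: mult_pCons_left mult_pCons_right)
qed simp

lemma lead_coeff_prod_linear: "lead_coeff (\<Prod>z\<in>Z. [:- z, 1:] :: int poly) = 1"
  by (subst lead_coeff_prod) simp

lemma degree_prod_linear: "finite Z \<Longrightarrow> degree (\<Prod>z\<in>Z. [:- z, 1:] :: int poly) = card Z"
  by (subst degree_prod_eq_sum_degree) auto

text \<open>A rational Newton polynomial takes the values of \<open>f\<close>. Dividing it by the product of the linear
  factors of \<open>r\<close> roots only sees its terms of order at least \<open>r\<close>, whose coefficients are divisible by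
  \<open>2 ^ r\<close> in the localization at 2, because \<open>4 ^ j / j!\<close> is divisible by \<open>2 ^ j\<close>.\<close>

lemma flat_dvd:
  assumes f: "flat f" and Z: "finite Z" "\<And>z. z \<in> Z \<Longrightarrow> f z = 0"
  shows "2 ^ card Z dvd f k"
proof -
  define r where "r = card Z"
  obtain K where K: "k \<le> K" "\<And>z. z \<in> Z \<Longrightarrow> z \<le> K"
    using finite_nat_set_iff_bounded_le[of "insert k Z"] Z(1) by auto
  obtain L :: nat where L: "odd L" "\<And>j. j \<le> K \<Longrightarrow> fact j dvd L * 2 ^ j"
    using odd_multiple_fact_dvd by blast
  have "\<exists>t. int L * 2 ^ j = fact j * t" if jK: "j \<le> K" for j
  proof -
    obtain t where "L * 2 ^ j = fact j * t" using L(2)[OF jK] by (rule dvdE) blast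
    then have "int L * 2 ^ j = fact j * int t" by (metis of_nat_fact of_nat_mult of_nat_numeral of_nat_power)
    then show ?thesis by blast
  qed
  then obtain t where t: "\<And>j. j \<le> K \<Longrightarrow> int L * 2 ^ j = fact j * t j" by metis
  have "\<exists>c. (fdiff ^^ j) f 0 = 4 ^ j * c" for j using f unfolding flat_def dvd_def by blast
  then obtain c where c: "\<And>j. (fdiff ^^ j) f 0 = 4 ^ j * c j" by metis
  define b :: "nat \<Rightarrow> int poly" where "b j = (\<Prod>i<j. [:- int i, 1:])" for j
  have deg_b: "degree (b j) = j" for j
    unfolding b_def by (subst degree_prod_eq_sum_degree) auto
  \<comment> \<open>\<open>s j\<close> is \<open>L\<close> times the \<open>j\<close>-th Newton
    term: \<open>L * 4 ^ j / j!\<close> equals \<open>2 ^ j * t j\<close>, and \<open>b j\<close> is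
    \<open>j!\<close> times the binomial coefficient as a polynomial.\<close>
  define s where "s = (\<lambda>j. smult (c j * t j * 2 ^ j) (b j))"
  define G where "G = (\<Sum>j\<le>K. s j)"
  have G: "poly G (int n) = int L * f n" if "n \<le> K" for n
  proof -
    have "poly (s j) (int n) = int L * (int (n choose j) * (fdiff ^^ j) f 0)" if "j \<le> K" for j
    proof -
      have "poly (s j) (int n) = c j * 2 ^ j * (fact j * t j) * int (n choose j)"
        by (simp add: s_def b_def poly_prod prod_diff_eq_fact_binomial)
      also have "\<dots> = int L * (int (n choose j) * ((2 * 2) ^ j * c j))"
        unfolding t[OF that, symmetric] power_mult_distrib by (simp add: algebra_simps)
      finally show ?thesis by (simp add: c)
    qed
    then show ?thesis
      by (subst newton_forward_le[OF that]) (simp add: G_def poly_sum sum_distrib_left)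
  qed
  define D where "D = (\<Prod>z\<in>int ` Z. [:- z, 1:])"
  have D: "lead_coeff D = 1" "degree D = r"
    using degree_prod_linear[of "int ` Z"] Z(1)
    by (simp_all only: D_def lead_coeff_prod_linear r_def) (simp add: card_image)
  have "D dvd G" unfolding D_def using Z K(2) by (intro prod_linear_dvd) (auto simp: G)
  then obtain h where h: "G = D * h" by (auto elim: dvdE)
  define H where "H = (\<Sum>j\<in>{j. j \<le> K \<and> r \<le> j}. smult (c j * t j * 2 ^ (j - r)) (b j))"
  define G0 where "G0 = (\<Sum>j\<in>{j. j \<le> K \<and> j < r}. s j)"
  have "G = G0 + (\<Sum>j\<in>{j. j \<le> K \<and> r \<le> j}. s j)"
    unfolding G_def G0_def by (subst sum.union_disjoint[symmetric]) (auto intro!: sum.cong)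
  also have "(\<Sum>j\<in>{j. j \<le> K \<and> r \<le> j}. s j) = smult (2 ^ r) H"
  proof -
    have "2 ^ r * (c j * t j * 2 ^ (j - r)) = c j * t j * 2 ^ j" if "r \<le> j" for j
      using that by (simp add: power_add[symmetric] mult.left_commute)
    then show ?thesis
      unfolding H_def s_def poly_eq_iff coeff_sum coeff_smult sum_distrib_left
      by (metis (mono_tags, lifting) mem_Collect_eq mult.assoc sum.cong)
  qed
  finally have "D * h = G0 + smult (2 ^ r) H" using h by simp
  moreover have "degree G0 < degree D \<or> G0 = 0"
  proof (cases "r = 0")
    case True then show ?thesis by (simp add: G0_def)
  next
    case False
    have "degree (s j) \<le> r - 1" if "j < r" for j
      using that degree_smult_le[of "c j * t j * 2 ^ j" "b j"] by (simp add: s_def deg_b)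
    then have "degree G0 \<le> r - 1" unfolding G0_def by (intro degree_sum_le) auto
    with False have "degree G0 < r" by linarith
    with D show ?thesis by simp
  qed
  ultimately obtain q where "h = smult (2 ^ r) q" using monic_quotient_dvd[OF D(1)] by blast
  then have "int L * f k = 2 ^ r * (poly D (int k) * poly q (int k))"
    using G[OF K(1)] by (simp add: h)
  then have "2 ^ r dvd int L * f k" by simp
  moreover have "coprime (2 ^ r) (int L)" using L(1) by simp
  ultimately show ?thesis by (simp add: coprime_dvd_mult_right_iff r_def)
qed

text \<open>An analogue of Strassmann's theorem: a nonzero value would be divisible by arbitrarily
  high powers of 2. As many zeros as its absolute value already give too large a divisor.\<close>

lemma flat_infinite_zeros:
  assumes f: "flat f" and inf: "infinite {k. f k = 0}"
  shows "f k = 0"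
proof (rule ccontr)
  assume nz: "f k \<noteq> 0"
  obtain Z where Z: "finite Z" "card Z = nat \<bar>f k\<bar>" "Z \<subseteq> {k. f k = 0}"
    using infinite_arbitrarily_large[OF inf] by blast
  have "2 ^ nat \<bar>f k\<bar> dvd f k" using flat_dvd[OF f Z(1), of k] Z by auto
  then have "2 ^ nat \<bar>f k\<bar> \<le> \<bar>f k\<bar>" using nz by (metis abs_ge_self dvd_abs_iff order_trans zdvd_imp_le zero_less_abs_iff)
  moreover have "int (nat \<bar>f k\<bar>) < 2 ^ nat \<bar>f k\<bar>" by (metis of_nat_less_two_power)
  ultimately show False by simp
qed

section \<open>Powers of matrices and companion matrices\<close>

lemma index_mult_mat_sum:
  assumes "A \<in> carrier_mat n m" "B \<in> carrier_mat m l" "i < n" "j < l"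
  shows "(A * B) $$ (i, j) = (\<Sum>k<m. A $$ (i, k) * B $$ (k, j))"
  using assms by (auto simp: scalar_prod_def atLeast0LessThan)

lemma pow_mat_add:
  assumes "(A :: 'a :: semiring_1 mat) \<in> carrier_mat n n"
  shows "A ^\<^sub>m (k + l) = A ^\<^sub>m k * A ^\<^sub>m l"
proof (induction l)
  case 0 then show ?case using assms by simp
next
  case (Suc l)
  then show ?case using assms by (simp add: assoc_mult_mat[of _ n n _ n _ n])
qed

lemma pow_mat_mult:
  assumes "(A :: 'a :: semiring_1 mat) \<in> carrier_mat n n"
  shows "A ^\<^sub>m (k * l) = (A ^\<^sub>m k) ^\<^sub>m l"
proof (induction l)
  case (Suc l)
  have "A ^\<^sub>m (k * Suc l) = A ^\<^sub>m (k * l + k)" by (simp add: add.commute)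
  then show ?case using Suc by (simp add: pow_mat_add[OF assms])
qed (use assms in simp)

lemma pow_mat_commute:
  assumes "(A :: 'a :: semiring_1 mat) \<in> carrier_mat n n"
  shows "A ^\<^sub>m k * A ^\<^sub>m l = A ^\<^sub>m l * A ^\<^sub>m k"
  using pow_mat_add[OF assms, of k l] pow_mat_add[OF assms, of l k] by (simp add: add.commute)

lemma pow_mat_commute_left:
  assumes "(A :: 'a :: semiring_1 mat) \<in> carrier_mat n n" "X \<in> carrier_mat n n" "X * A = A * X"
  shows "X * A ^\<^sub>m k = A ^\<^sub>m k * X"
proof (induction k)
  case (Suc k)
  have "X * (A ^\<^sub>m k * A) = X * A ^\<^sub>m k * A"
    using assms by (simp add: assoc_mult_mat[of _ n n _ n _ n])
  also have "\<dots> = A ^\<^sub>m k * (X * A)"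
    using assms Suc by (simp add: assoc_mult_mat[of _ n n _ n _ n])
  also have "\<dots> = A ^\<^sub>m k * A * X"
    using assms by (simp add: assoc_mult_mat[of _ n n _ n _ n])
  finally show ?case by simp
qed (use assms in simp)

lemma pow_mat_left_inverse:
  assumes A: "(A :: 'a :: semiring_1 mat) \<in> carrier_mat n n" and B: "B \<in> carrier_mat n n" "B * A = 1\<^sub>m n"
  shows "B ^\<^sub>m i * A ^\<^sub>m i = 1\<^sub>m n"
proof (induction i)
  case (Suc i)
  have "A ^\<^sub>m Suc i = A * A ^\<^sub>m i" using pow_mat_commute[OF A, of 1 i] A by simp
  then have "B ^\<^sub>m Suc i * A ^\<^sub>m Suc i = B ^\<^sub>m i * B * (A * A ^\<^sub>m i)" by simp
  also have "\<dots> = B ^\<^sub>m i * (B * A * A ^\<^sub>m i)"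
    using A B(1) by (simp add: assoc_mult_mat[of _ n n _ n _ n] mult_carrier_mat[of _ n n _ n])
  finally show ?case using A B Suc by simp
qed (use A B in simp)

lemma pow_mat_eq_imp_one:
  assumes A: "(A :: 'a :: semiring_1 mat) \<in> carrier_mat n n" and B: "B \<in> carrier_mat n n" "B * A = 1\<^sub>m n"
    and eq: "A ^\<^sub>m (i + k) = A ^\<^sub>m i"
  shows "A ^\<^sub>m k = 1\<^sub>m n"
proof -
  have "A ^\<^sub>m k = B ^\<^sub>m i * A ^\<^sub>m i * A ^\<^sub>m k" using A pow_mat_left_inverse[OF A B] by simp
  also have "\<dots> = B ^\<^sub>m i * A ^\<^sub>m (i + k)"
    using A B(1) by (simp add: pow_mat_add[OF A] assoc_mult_mat[of _ n n _ n _ n])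
  also have "\<dots> = 1\<^sub>m n" using pow_mat_left_inverse[OF A B] eq by simp
  finally show ?thesis .
qed

text \<open>A companion matrix shifts the basis vectors, so its powers send the first one to all the
  others in turn. For \<open>j < d\<close> the arbitrary last column does not enter the
  computation.\<close>

lemma companion_pow_col:
  assumes C: "companion_mat d C" and "i < d" "j < d"
  shows "(C ^\<^sub>m j) $$ (i, 0) = (if i = j then 1 else 0)"
  using assms(2,3)
proof (induction j arbitrary: i)
  case 0
  then show ?case using C by (auto simp: companion_mat_def)
next
  case (Suc j)
  have Cd: "C \<in> carrier_mat d d" using C by (simp add: companion_mat_def)
  have "C ^\<^sub>m Suc j = C * C ^\<^sub>m j"
    using pow_mat_commute[OF Cd, of 1 j] Cd by simp
  then have "(C ^\<^sub>m Suc j) $$ (i, 0) = (\<Sum>k<d. C $$ (i, k) * (C ^\<^sub>m j) $$ (k, 0))"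
    using index_mult_mat_sum[OF Cd pow_carrier_mat[OF Cd], of i 0 j] Suc.prems by simp
  also have "\<dots> = (\<Sum>k<d. if k = j then C $$ (i, k) else 0)"
    using Suc by (intro sum.cong) auto
  also have "\<dots> = C $$ (i, j)" using Suc.prems by simp
  also have "\<dots> = (if i = Suc j then 1 else 0)"
    using C Suc.prems by (auto simp: companion_mat_def)
  finally show ?case .
qed

text \<open>Column \<open>j\<close> of \<open>X\<close> is \<open>X C^j e = C^j X e\<close>, with
  \<open>e\<close> the first basis vector. Expanding \<open>X e\<close> in the basis of the vectors
  \<open>C^l e\<close> shows that \<open>X\<close> is a polynomial in \<open>C\<close> whose
  coefficients are the first column of \<open>X\<close>.\<close>

lemma companion_centralizer:
  assumes C: "companion_mat d C" and X: "X \<in> carrier_mat d d" and comm: "X * C = C * X"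
    and ij: "i < d" "j < d"
  shows "X $$ (i, j) = (\<Sum>l<d. (C ^\<^sub>m l) $$ (i, j) * X $$ (l, 0))"
proof -
  have Cd: "C \<in> carrier_mat d d" using C by (simp add: companion_mat_def)
  note P = pow_carrier_mat[OF Cd]
  have mult_col: "(Y * C ^\<^sub>m j) $$ (i, 0) = Y $$ (i, j)" if "Y \<in> carrier_mat d d" "j < d" for Y j
    using index_mult_mat_sum[OF that(1) P, of i 0 j] ij that companion_pow_col[OF C]
    by (simp add: sum.delta if_distrib[of "(*) _"] cong: if_cong)
  have "X $$ (i, j) = (C ^\<^sub>m j * X) $$ (i, 0)"
    using mult_col[OF X] pow_mat_commute_left[OF Cd X comm] ij by simp
  also have "\<dots> = (\<Sum>l<d. (C ^\<^sub>m j) $$ (i, l) * X $$ (l, 0))"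
    using index_mult_mat_sum[OF P X] ij by simp
  also have "\<dots> = (\<Sum>l<d. (C ^\<^sub>m l) $$ (i, j) * X $$ (l, 0))"
    using mult_col[OF P] pow_mat_commute[OF Cd] ij by (intro sum.cong refl) (metis lessThan_iff)
  finally show ?thesis .
qed

lemma conjugate_companion_centralizer:
  assumes A: "A \<in> carrier_mat d d" and conj: "conjugate_to_companion d A"
    and X: "X \<in> carrier_mat d d" "X * A = A * X"
  shows "\<exists>c. \<forall>i<d. \<forall>j<d. X $$ (i, j) = (\<Sum>l<d. (A ^\<^sub>m l) $$ (i, j) * c l)"
proof -
  obtain C P Q where C: "companion_mat d C" and wit: "similar_mat_wit A C P Q"
    using conj by (auto simp: conjugate_to_companion_def similar_mat_def)
  from similar_mat_witD2[OF A wit]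
  have PQ: "P * Q = 1\<^sub>m d" "Q * P = 1\<^sub>m d" "A = P * C * Q" "C \<in> carrier_mat d d"
    "P \<in> carrier_mat d d" "Q \<in> carrier_mat d d" by auto
  note asc = assoc_mult_mat[of _ d d _ d _ d]
  define Y where "Y = Q * X * P"
  have Y: "Y \<in> carrier_mat d d" using X PQ by (simp add: Y_def)
  have QA: "Q * A = C * Q"
  proof -
    have "Q * A = Q * P * (C * Q)" using PQ(3-6) by (simp add: asc)
    then show ?thesis using PQ by simp
  qed
  have AP: "A * P = P * C"
  proof -
    have "A * P = P * C * (Q * P)" using PQ(3-6) by (simp add: asc)
    then show ?thesis using PQ by simp
  qed
  have "Y * C = Q * X * (A * P)" using X PQ(4-6) by (simp add: Y_def asc AP)
  also have "\<dots> = Q * (X * A) * P"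
    using X(1) A PQ(5,6) by (simp add: asc mult_carrier_mat[of _ d d _ d])
  also have "\<dots> = Q * A * (X * P)"
    unfolding X(2) using X(1) A PQ(5,6) by (simp add: asc mult_carrier_mat[of _ d d _ d])
  also have "\<dots> = C * Y" using X PQ(4-6) by (simp add: Y_def asc QA)
  finally have YC: "Y * C = C * Y" .
  \<comment> \<open>\<open>X\<close> is the same polynomial in \<open>A\<close> as \<open>Y\<close>
    is in \<open>C\<close>, so the coefficients come from the first column of
    \<open>Y\<close>.\<close>
  define c where "c l = Y $$ (l, 0)" for l
  have XY: "X = P * Y * Q"
  proof -
    have "P * Y * Q = P * Q * X * (P * Q)" using X PQ(5,6) by (simp add: Y_def asc)
    then show ?thesis using X PQ by simp
  qed
  have "X $$ (i, j) = (\<Sum>l<d. (A ^\<^sub>m l) $$ (i, j) * c l)" if ij: "i < d" "j < d" for i j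
  proof -
    have ent: "(P * Z * Q) $$ (i, j) = (\<Sum>b<d. \<Sum>a<d. P $$ (i, a) * Z $$ (a, b) * Q $$ (b, j))"
      if "Z \<in> carrier_mat d d" for Z
    proof -
      have "P * Z \<in> carrier_mat d d" using PQ that by simp
      from index_mult_mat_sum[OF this PQ(6) ij]
      show ?thesis using index_mult_mat_sum[OF PQ(5) that] ij by (simp add: sum_distrib_right)
    qed
    have "X $$ (i, j) = (\<Sum>b<d. \<Sum>a<d. P $$ (i, a) * (\<Sum>l<d. (C ^\<^sub>m l) $$ (a, b) * c l) * Q $$ (b, j))"
      unfolding XY ent[OF Y] using companion_centralizer[OF C Y YC]
      by (intro sum.cong refl) (simp add: c_def)
    also have "\<dots> = (\<Sum>b<d. \<Sum>a<d. \<Sum>l<d. P $$ (i, a) * (C ^\<^sub>m l) $$ (a, b) * Q $$ (b, j) * c l)"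
      by (simp add: sum_distrib_left sum_distrib_right mult_ac)
    also have "\<dots> = (\<Sum>b<d. \<Sum>l<d. \<Sum>a<d. P $$ (i, a) * (C ^\<^sub>m l) $$ (a, b) * Q $$ (b, j) * c l)"
      by (intro sum.cong refl sum.swap)
    also have "\<dots> = (\<Sum>l<d. \<Sum>b<d. \<Sum>a<d. P $$ (i, a) * (C ^\<^sub>m l) $$ (a, b) * Q $$ (b, j) * c l)"
      by (rule sum.swap)
    also have "\<dots> = (\<Sum>l<d. (P * C ^\<^sub>m l * Q) $$ (i, j) * c l)"
      using ent[OF pow_carrier_mat[OF PQ(4)]] by (simp add: sum_distrib_right)
    also have "\<dots> = (\<Sum>l<d. (A ^\<^sub>m l) $$ (i, j) * c l)"
      using similar_mat_wit_pow_id[OF wit] by simp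
    finally show ?thesis .
  qed
  then show ?thesis by blast
qed

text \<open>The columns are \<open>e\<close>, \<open>A e\<close>, \<open>A^2 e\<close> and so on,
  for the first basis vector \<open>e\<close>. Over the integers, determinant 1 or -1 means that
  they form a lattice basis.\<close>

definition krylov_mat :: "nat \<Rightarrow> 'a :: semiring_1 mat \<Rightarrow> 'a mat" where
  "krylov_mat d A = mat d d (\<lambda>(i, j). (A ^\<^sub>m j) $$ (i, 0))"

text \<open>Powers of \<open>A ^\<^sub>m m\<close> commute with \<open>A ^\<^sub>m n\<close> and so
  are integer polynomials in it. Their first columns, for exponents below \<open>d\<close>, are the
  standard basis vectors; hence the Krylov matrix has an integral right inverse
  \<open>B\<close>.\<close>

lemma det_krylov_unit:
  fixes A :: "int mat"
  assumes A: "A \<in> carrier_mat d d" and C: "companion_mat d (A ^\<^sub>m m)"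
    and conj: "conjugate_to_companion d (A ^\<^sub>m n)"
  shows "\<bar>det (krylov_mat d (A ^\<^sub>m n))\<bar> = 1"
proof -
  note P = pow_carrier_mat[OF A]
  have "\<exists>c. \<forall>i<d. ((A ^\<^sub>m m) ^\<^sub>m j) $$ (i, 0) = (\<Sum>l<d. ((A ^\<^sub>m n) ^\<^sub>m l) $$ (i, 0) * c l)" for j
  proof -
    have "(A ^\<^sub>m m) ^\<^sub>m j * A ^\<^sub>m n = A ^\<^sub>m n * (A ^\<^sub>m m) ^\<^sub>m j"
      by (simp add: pow_mat_mult[OF A, symmetric] pow_mat_commute[OF A])
    from conjugate_companion_centralizer[OF P conj pow_carrier_mat[OF P] this] show ?thesis
      by (metis gr_implies_not0 neq0_conv)
  qed
  then obtain c where c: "\<And>i j. i < d \<Longrightarrow>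
      ((A ^\<^sub>m m) ^\<^sub>m j) $$ (i, 0) = (\<Sum>l<d. ((A ^\<^sub>m n) ^\<^sub>m l) $$ (i, 0) * c j l)" by metis
  define B where "B = mat d d (\<lambda>(l, j). c j l)"
  have B: "B \<in> carrier_mat d d" and K: "krylov_mat d (A ^\<^sub>m n) \<in> carrier_mat d d"
    by (simp_all add: B_def krylov_mat_def)
  have "krylov_mat d (A ^\<^sub>m n) * B = 1\<^sub>m d"
  proof (rule eq_matI)
    fix i j assume "i < dim_row (1\<^sub>m d :: int mat)" "j < dim_col (1\<^sub>m d :: int mat)"
    then have ij: "i < d" "j < d" by auto
    have "(krylov_mat d (A ^\<^sub>m n) * B) $$ (i, j) = (\<Sum>l<d. ((A ^\<^sub>m n) ^\<^sub>m l) $$ (i, 0) * c j l)"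
      using index_mult_mat_sum[OF K B ij] ij by (simp add: B_def krylov_mat_def)
    also have "\<dots> = ((A ^\<^sub>m m) ^\<^sub>m j) $$ (i, 0)" using c ij by simp
    finally show "(krylov_mat d (A ^\<^sub>m n) * B) $$ (i, j) = 1\<^sub>m d $$ (i, j)"
      using companion_pow_col[OF C ij] ij by simp
  qed (use B K in auto)
  then have "det (krylov_mat d (A ^\<^sub>m n)) * det B = 1" using det_mult[OF K B] by simp
  then show ?thesis by (metis abs_zmult_eq_1 abs_1)
qed

section \<open>Eigenvalues of roots of companion matrices\<close>

definition colpoly :: "nat \<Rightarrow> int mat \<Rightarrow> nat \<Rightarrow> complex poly" where
  "colpoly d X j = (\<Sum>i<d. monom (of_int (X $$ (i, j))) i)"

text \<open>In the basis \<open>1, x, x\<^sup>2, \<dots>\<close> of polynomials modulo \<open>f\<close>, the matrix \<open>X\<close> is multiplication by \<open>p\<close>.\<close>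

definition acts_mod :: "complex poly \<Rightarrow> nat \<Rightarrow> int mat \<Rightarrow> complex poly \<Rightarrow> bool" where
  "acts_mod f d X p \<longleftrightarrow> (\<forall>j<d. f dvd colpoly d X j - p * monom 1 j)"

text \<open>For a companion matrix this is the characteristic polynomial, read off the last column
  as the relation expressing \<open>x^d\<close> by lower powers.\<close>

definition companion_poly :: "nat \<Rightarrow> int mat \<Rightarrow> complex poly" where
  "companion_poly d C = monom 1 d - colpoly d C (d - 1)"

lemma colpoly_mult:
  assumes "X \<in> carrier_mat d d" "Y \<in> carrier_mat d d" "j < d"
  shows "colpoly d (X * Y) j = (\<Sum>l<d. smult (of_int (Y $$ (l, j))) (colpoly d X l))"
proof -
  have "colpoly d (X * Y) j = (\<Sum>i<d. \<Sum>l<d. monom (of_int (X $$ (i, l)) * of_int (Y $$ (l, j))) i)"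
    unfolding colpoly_def using assms
    by (intro sum.cong refl) (simp add: index_mult_mat_sum[OF assms(1,2)] poly_eq_iff coeff_sum del: index_mult_mat)
  also have "\<dots> = (\<Sum>l<d. \<Sum>i<d. monom (of_int (X $$ (i, l)) * of_int (Y $$ (l, j))) i)"
    by (rule sum.swap)
  also have "\<dots> = (\<Sum>l<d. smult (of_int (Y $$ (l, j))) (colpoly d X l))"
    unfolding colpoly_def poly_eq_iff
    by (auto simp: coeff_sum sum_distrib_left mult.commute intro!: sum.cong)
  finally show ?thesis .
qed

lemma acts_mod_mult:
  assumes X: "X \<in> carrier_mat d d" "acts_mod f d X p" and Y: "Y \<in> carrier_mat d d" "acts_mod f d Y q"
  shows "acts_mod f d (X * Y) (p * q)"
  unfolding acts_mod_def
proof (intro allI impI)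
  fix j assume j: "j < d"
  have "colpoly d Y j = (\<Sum>l<d. smult (of_int (Y $$ (l, j))) (monom 1 l))"
    by (simp add: colpoly_def smult_monom)
  then have "colpoly d (X * Y) j - p * q * monom 1 j =
      (\<Sum>l<d. smult (of_int (Y $$ (l, j))) (colpoly d X l - p * monom 1 l))
      + p * (colpoly d Y j - q * monom 1 j)"
    by (simp add: colpoly_mult[OF X(1) Y(1) j] smult_diff_right sum_subtractf sum_distrib_left algebra_simps)
  moreover have "f dvd (\<Sum>l<d. smult (of_int (Y $$ (l, j))) (colpoly d X l - p * monom 1 l))"
    using X(2) by (intro dvd_sum dvd_smult) (auto simp: acts_mod_def)
  moreover have "f dvd p * (colpoly d Y j - q * monom 1 j)"
    using Y(2) j by (intro dvd_mult) (auto simp: acts_mod_def)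
  ultimately show "f dvd colpoly d (X * Y) j - p * q * monom 1 j" by simp
qed

lemma acts_mod_add:
  assumes X: "X \<in> carrier_mat d d" "acts_mod f d X p" and Y: "Y \<in> carrier_mat d d" "acts_mod f d Y q"
  shows "acts_mod f d (X + Y) (p + q)"
  unfolding acts_mod_def
proof (intro allI impI)
  fix j assume j: "j < d"
  have "colpoly d (X + Y) j - (p + q) * monom 1 j =
      (colpoly d X j - p * monom 1 j) + (colpoly d Y j - q * monom 1 j)"
    using X(1) Y(1) j by (simp add: colpoly_def sum.distrib algebra_simps add_monom[symmetric])
  then show "f dvd colpoly d (X + Y) j - (p + q) * monom 1 j"
    using X Y j by (auto simp: acts_mod_def)
qed

lemma acts_mod_scalar: "acts_mod f d (c \<cdot>\<^sub>m 1\<^sub>m d) [:of_int c:]"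
proof -
  have "colpoly d (c \<cdot>\<^sub>m 1\<^sub>m d) j = [:of_int c:] * monom 1 j" if "j < d" for j
  proof -
    have "colpoly d (c \<cdot>\<^sub>m 1\<^sub>m d) j = (\<Sum>i<d. if i = j then monom (of_int c) i else 0)"
      unfolding colpoly_def using that by (intro sum.cong) auto
    then show ?thesis using that by (simp add: smult_monom)
  qed
  then show ?thesis by (simp add: acts_mod_def)
qed

lemma acts_mod_one: "acts_mod f d (1\<^sub>m d) 1"
proof -
  have "(1 :: int) \<cdot>\<^sub>m 1\<^sub>m d = 1\<^sub>m d" by (intro eq_matI) auto
  with acts_mod_scalar[of f d 1] show ?thesis by (simp add: one_pCons)
qed

lemma acts_mod_pow:
  assumes "X \<in> carrier_mat d d" "acts_mod f d X p"
  shows "acts_mod f d (X ^\<^sub>m m) (p ^ m)"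
proof (induction m)
  case (Suc m)
  from acts_mod_mult[OF pow_carrier_mat[OF assms(1)] Suc assms] show ?case by (simp add: mult.commute)
qed (use assms acts_mod_one in simp)

lemma acts_mod_companion:
  assumes C: "companion_mat d C"
  shows "acts_mod (companion_poly d C) d C [:0, 1:]"
  unfolding acts_mod_def
proof (intro allI impI)
  fix j assume j: "j < d"
  have x: "[:0, 1:] * monom 1 j = (monom 1 (Suc j) :: complex poly)" by (simp add: monom_Suc)
  show "companion_poly d C dvd colpoly d C j - [:0, 1:] * monom 1 j"
  proof (cases "j < d - 1")
    case True
    then have "colpoly d C j = (\<Sum>i<d. if i = Suc j then monom 1 i else 0)"
      unfolding colpoly_def using C by (intro sum.cong) (auto simp: companion_mat_def)
    moreover have "Suc j < d" using True by simp
    ultimately show ?thesis using x by simp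
  next
    case False
    then have "Suc j = d" using j by simp
    \<comment> \<open>Only in the last column is a reduction needed: there the difference is the
      modulus itself up to sign.\<close>
    then have "colpoly d C j - [:0, 1:] * monom 1 j = - companion_poly d C"
      unfolding x by (auto simp: companion_poly_def)
    then show ?thesis by simp
  qed
qed

text \<open>Write \<open>1\<close> for the first basis vector; then
  \<open>A x^j = A C^j 1 = C^j A 1\<close>, and \<open>C\<close> multiplies by \<open>x\<close>. So
  \<open>A\<close> is multiplication by its own first column.\<close>

lemma acts_mod_commuting:
  assumes C: "companion_mat d C" and A: "A \<in> carrier_mat d d" and comm: "A * C = C * A"
  shows "acts_mod (companion_poly d C) d A (colpoly d A 0)"
  unfolding acts_mod_def
proof (intro allI impI)
  fix j assume j: "j < d"
  let ?f = "companion_poly d C"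
  have Cd: "C \<in> carrier_mat d d" using C by (simp add: companion_mat_def)
  note P = pow_carrier_mat[OF Cd]
  have "colpoly d (A * C ^\<^sub>m j) 0 = (\<Sum>l<d. smult (of_int ((C ^\<^sub>m j) $$ (l, 0))) (colpoly d A l))"
    using j by (intro colpoly_mult[OF A P]) auto
  also have "\<dots> = (\<Sum>l<d. if l = j then colpoly d A l else 0)"
    by (intro sum.cong refl) (auto simp: companion_pow_col[OF C _ j])
  finally have "colpoly d A j = colpoly d (C ^\<^sub>m j * A) 0"
    using j pow_mat_commute_left[OF Cd A comm] by simp
  also have "\<dots> = (\<Sum>l<d. smult (of_int (A $$ (l, 0))) (colpoly d (C ^\<^sub>m j) l))"
    using j by (subst colpoly_mult[OF P A]) auto
  finally have "colpoly d A j - colpoly d A 0 * monom 1 j =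
      (\<Sum>l<d. smult (of_int (A $$ (l, 0))) (colpoly d (C ^\<^sub>m j) l - [:0, 1:] ^ j * monom 1 l))"
    by (simp add: colpoly_def[of d A 0] smult_diff_right sum_subtractf sum_distrib_right smult_monom
        mult_monom monom_altdef[of 1, symmetric] add.commute x_as_monom monom_power)
  moreover have "?f dvd (\<Sum>l<d. smult (of_int (A $$ (l, 0))) (colpoly d (C ^\<^sub>m j) l - [:0, 1:] ^ j * monom 1 l))"
    using acts_mod_pow[OF Cd acts_mod_companion[OF C], of j]
    by (intro dvd_sum dvd_smult) (auto simp: acts_mod_def)
  ultimately show "?f dvd colpoly d A j - colpoly d A 0 * monom 1 j" by simp
qed

text \<open>At a root \<open>\<mu>\<close> of \<open>f\<close> the congruence becomes an equality:
  the row of powers of \<open>\<mu>\<close> is a left eigenvector of \<open>X\<close> for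
  \<open>poly p \<mu>\<close>.\<close>

lemma acts_mod_eval:
  assumes "acts_mod f d X p" "poly f \<mu> = 0" "j < d"
  shows "(\<Sum>i<d. \<mu> ^ i * of_int (X $$ (i, j))) = poly p \<mu> * \<mu> ^ j"
proof -
  obtain s where "colpoly d X j - p * monom 1 j = f * s" using assms by (auto simp: acts_mod_def elim: dvdE)
  then have "poly (colpoly d X j - p * monom 1 j) \<mu> = 0" using assms(2) by simp
  then show ?thesis by (simp add: colpoly_def poly_sum poly_monom mult.commute)
qed

text \<open>The witness is the matrix \<open>q(C)\<close>, built by Horner's scheme.\<close>

lemma acts_mod_int_poly:
  assumes C: "companion_mat d C"
  shows "\<exists>G\<in>carrier_mat d d. acts_mod (companion_poly d C) d G (map_poly of_int q)"
proof (induction q)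
  case 0
  show ?case using acts_mod_scalar[of _ d 0] by (intro bexI[of _ "0 \<cdot>\<^sub>m 1\<^sub>m d"]) auto
next
  case (pCons c q)
  then obtain G where G: "G \<in> carrier_mat d d" "acts_mod (companion_poly d C) d G (map_poly of_int q)" by blast
  have Cd: "C \<in> carrier_mat d d" using C by (simp add: companion_mat_def)
  have "acts_mod (companion_poly d C) d (c \<cdot>\<^sub>m 1\<^sub>m d + C * G) ([:of_int c:] + [:0, 1:] * map_poly of_int q)"
    using Cd G by (intro acts_mod_add acts_mod_scalar acts_mod_mult acts_mod_companion C) auto
  then show ?case using Cd G by (intro bexI[of _ "c \<cdot>\<^sub>m 1\<^sub>m d + C * G"]) (auto simp: of_int_hom.map_poly_pCons_hom)
qed

lemma companion_poly_degree:
  assumes "d > 0"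
  shows "lead_coeff (companion_poly d C) = 1" "degree (companion_poly d C) = d"
proof -
  have "degree (colpoly d C (d - 1)) \<le> d - 1"
    unfolding colpoly_def by (intro degree_sum_le) (auto intro: order_trans[OF degree_monom_le])
  then have less: "degree (colpoly d C (d - 1)) < d" using assms by linarith
  then show deg: "degree (companion_poly d C) = d"
    unfolding companion_poly_def diff_conv_add_uminus
    by (subst degree_add_eq_left) (auto simp: degree_monom_eq)
  show "lead_coeff (companion_poly d C) = 1"
    unfolding deg using less by (simp add: companion_poly_def coeff_eq_0)
qed

text \<open>The value is an eigenvalue of the integer matrix \<open>G\<close>, hence a root of a
  monic integer polynomial. The transpose enters because the known eigenvector is a row, while
  \<open>eigenvalue\<close> speaks of columns.\<close>

lemma algebraic_int_poly_root:
  assumes C: "companion_mat d C" and d: "d > 0" and \<mu>: "poly (companion_poly d C) \<mu> = 0"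
  shows "algebraic_int (poly (map_poly of_int q) \<mu>)"
proof -
  obtain G where G: "G \<in> carrier_mat d d" "acts_mod (companion_poly d C) d G (map_poly of_int q)"
    using acts_mod_int_poly[OF C] by blast
  let ?\<gamma> = "poly (map_poly of_int q) \<mu>"
  define H where "H = map_mat (of_int :: int \<Rightarrow> complex) (transpose_mat G)"
  have Gt: "transpose_mat G \<in> carrier_mat d d" using G by simp
  have H: "H \<in> carrier_mat d d" using Gt by (simp add: H_def)
  define w where "w = vec d (\<lambda>i. \<mu> ^ i)"
  have w: "w \<in> carrier_vec d" by (simp add: w_def)
  have "w $ 0 = 1" using d by (simp add: w_def)
  then have w0: "w \<noteq> 0\<^sub>v d" using d by auto
  have "H *\<^sub>v w = ?\<gamma> \<cdot>\<^sub>v w"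
  proof (rule eq_vecI)
    fix j assume "j < dim_vec (?\<gamma> \<cdot>\<^sub>v w)"
    then have j: "j < d" by (simp add: w_def)
    have "(H *\<^sub>v w) $ j = (\<Sum>i<d. \<mu> ^ i * of_int (G $$ (i, j)))"
      using H G(1) w j by (simp add: H_def scalar_prod_def w_def atLeast0LessThan mult.commute)
    also have "\<dots> = ?\<gamma> * \<mu> ^ j" by (rule acts_mod_eval[OF G(2) \<mu> j])
    finally show "(H *\<^sub>v w) $ j = (?\<gamma> \<cdot>\<^sub>v w) $ j" using j by (simp add: w_def)
  qed (use H w in auto)
  then have "eigenvalue H ?\<gamma>" using H w w0 by (auto simp: eigenvalue_def eigenvector_def)
  then have "poly (char_poly H) ?\<gamma> = 0" using eigenvalue_root_char_poly[OF H] by simp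
  moreover have "char_poly H = map_poly of_int (char_poly (transpose_mat G))"
    unfolding H_def by (rule of_int_hom.char_poly_hom[OF Gt])
  moreover have "lead_coeff (char_poly (transpose_mat G)) = 1" using degree_monic_char_poly[OF Gt] by auto
  ultimately show ?thesis unfolding algebraic_int_altdef_ipoly by auto
qed

text \<open>Differentiating \<open>x \<equiv> \<alpha>(x)\<^sup>n\<close> modulo \<open>f\<close> at a multiple root \<open>\<mu>\<close> of \<open>f\<close> would give
  \<open>1 = n \<alpha>(\<mu>)\<^sup>n\<^sup>-\<^sup>1 \<alpha>'(\<mu>)\<close>, although \<open>1 / n\<close> is not an algebraic integer.\<close>

lemma companion_power_rsquarefree:
  assumes A: "A \<in> carrier_mat d d" and C: "companion_mat d (A ^\<^sub>m n)" and d: "d \<ge> 2" and n: "n \<ge> 2"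
  shows "rsquarefree (companion_poly d (A ^\<^sub>m n))"
  unfolding rsquarefree_roots
proof (intro allI notI, elim conjE)
  fix \<mu> assume \<mu>: "poly (companion_poly d (A ^\<^sub>m n)) \<mu> = 0" "poly (pderiv (companion_poly d (A ^\<^sub>m n))) \<mu> = 0"
  define f where "f = companion_poly d (A ^\<^sub>m n)"
  define a :: "int poly" where "a = (\<Sum>i<d. monom (A $$ (i, 0)) i)"
  define \<alpha> :: "complex poly" where "\<alpha> = map_poly of_int a"
  have "\<alpha> = colpoly d A 0"
    by (simp add: \<alpha>_def a_def colpoly_def of_int_poly_hom.hom_sum)
  moreover have "A * A ^\<^sub>m n = A ^\<^sub>m n * A" using pow_mat_commute[OF A, of 1 n] A by simp
  ultimately have acts: "acts_mod f d A \<alpha>" using acts_mod_commuting[OF C A] by (simp add: f_def)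
  have d0: "0 < d" using d by simp
  \<comment> \<open>Column 0 of \<open>A ^\<^sub>m n\<close>, taken once as that of a power of
    \<open>A\<close> and once as that of a companion matrix, gives
    \<open>x \<equiv> \<alpha> ^ n\<close> modulo \<open>f\<close>.\<close>
  have "f dvd colpoly d (A ^\<^sub>m n) 0 - \<alpha> ^ n * monom 1 0"
    using acts_mod_pow[OF A acts] d0 unfolding acts_mod_def by blast
  moreover have "f dvd colpoly d (A ^\<^sub>m n) 0 - [:0, 1:] * monom 1 0"
    using acts_mod_companion[OF C] d0 unfolding acts_mod_def f_def by blast
  ultimately have "f dvd [:0, 1:] - \<alpha> ^ n"
    using dvd_diff[of f "colpoly d (A ^\<^sub>m n) 0 - \<alpha> ^ n" "colpoly d (A ^\<^sub>m n) 0 - [:0, 1:]"]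
    by (simp add: monom_eq_1)
  then obtain s where "[:0, 1:] - \<alpha> ^ n = f * s" by (auto elim: dvdE)
  then have "poly (pderiv ([:0, 1:] - \<alpha> ^ n)) \<mu> = 0"
    using \<mu> by (simp add: pderiv_mult f_def)
  then have "1 = of_nat n * poly (\<alpha> ^ (n - 1) * pderiv \<alpha>) \<mu>"
    using n by (simp add: pderiv_diff pderiv_power pderiv_pCons)
  moreover have "\<alpha> ^ (n - 1) * pderiv \<alpha> = map_poly of_int (a ^ (n - 1) * pderiv a)"
    by (simp add: \<alpha>_def of_int_poly_hom.hom_mult of_int_poly_hom.hom_power of_int_hom.map_poly_pderiv)
  ultimately have "1 = of_nat n * poly (map_poly of_int (a ^ (n - 1) * pderiv a)) \<mu>" by (simp only:)
  then have eq: "poly (map_poly of_int (a ^ (n - 1) * pderiv a)) \<mu> = 1 / of_nat n"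
    using n by (simp add: field_simps)
  have "algebraic_int (1 / of_nat n :: complex)"
    using algebraic_int_poly_root[OF C _ \<mu>(1), of "a ^ (n - 1) * pderiv a"] d unfolding eq by simp
  then have "(1 / of_nat n :: complex) \<in> \<int>"
    by (rule rational_algebraic_int_is_int) auto
  then obtain k :: int where "(1 / of_nat n :: complex) = of_int k" by (auto elim: Ints_cases)
  then have "(1 :: complex) = of_int (k * int n)" using n by (simp add: field_simps)
  then have "1 = k * int n" by (metis of_int_eq_1_iff)
  then have "int n dvd 1" by (metis dvd_triv_right)
  then show False using n by simp
qed

text \<open>The rows \<open>(1, \<mu>\<^sub>i, \<mu>\<^sub>i\<^sup>2, \<dots>)\<close> are left eigenvectors of \<open>A\<close>.\<close>

lemma companion_power_diagonalizable:
  assumes A: "A \<in> carrier_mat d d" and C: "companion_mat d (A ^\<^sub>m n)" and d: "d \<ge> 2" and n: "n \<ge> 2"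
  obtains \<mu> \<kappa> :: "nat \<Rightarrow> complex" where "inj_on \<mu> {..<d}"
    and "\<And>i j m. j < d \<Longrightarrow> i < d \<Longrightarrow> (\<Sum>l<d. \<mu> i ^ l * of_int ((A ^\<^sub>m m) $$ (l, j))) = \<kappa> i ^ m * \<mu> i ^ j"
proof -
  define f where "f = companion_poly d (A ^\<^sub>m n)"
  have f: "lead_coeff f = 1" "degree f = d" using companion_poly_degree d by (auto simp: f_def)
  have "rsquarefree f" using companion_power_rsquarefree[OF assms] by (simp add: f_def)
  from complex_poly_decompose_rsquarefree[OF this] f
  have "(\<Prod>z|poly f z = 0. [:- z, 1:]) = f" by simp
  moreover have fin: "finite {z. poly f z = 0}" using f d by (intro poly_roots_finite) auto
  moreover have "degree (\<Prod>z|poly f z = 0. [:- z, 1:]) = card {z. poly f z = 0}"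
    by (subst degree_prod_eq_sum_degree) auto
  ultimately have "card {z. poly f z = 0} = d" using f by simp
  then obtain \<mu> where \<mu>: "bij_betw \<mu> {..<d} {z. poly f z = 0}"
    using fin by (metis ex_bij_betw_nat_finite lessThan_atLeast0)
  have "A * A ^\<^sub>m n = A ^\<^sub>m n * A" using pow_mat_commute[OF A, of 1 n] A by simp
  from acts_mod_pow[OF A acts_mod_commuting[OF C A this]]
  have "acts_mod f d (A ^\<^sub>m m) (colpoly d A 0 ^ m)" for m by (simp add: f_def)
  from acts_mod_eval[OF this] bij_betwE[OF \<mu>]
  have "(\<Sum>l<d. \<mu> i ^ l * of_int ((A ^\<^sub>m m) $$ (l, j))) = poly (colpoly d A 0) (\<mu> i) ^ m * \<mu> i ^ j"
    if "j < d" "i < d" for i j m using that by simp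
  with bij_betw_imp_inj_on[OF \<mu>] show ?thesis by (intro that[of \<mu> "\<lambda>i. poly (colpoly d A 0) (\<mu> i)"]) auto
qed

section \<open>Vandermonde determinants and row scaling\<close>

lemma det_vandermonde:
  fixes x :: "nat \<Rightarrow> 'a :: idom"
  shows "det (mat n n (\<lambda>(i, j). x i ^ j)) = (\<Prod>j<n. \<Prod>l<j. x j - x l)"
proof -
  define V where "V = mat n n (\<lambda>(i, j). x i ^ j)"
  define p where "p j = (\<Prod>l<j. [:- x l, 1:])" for j
  have deg: "degree (p j) = j" for j
    unfolding p_def by (subst degree_prod_eq_sum_degree) auto
  have lc: "coeff (p j) j = 1" for j
  proof -
    have "lead_coeff (p j) = 1" unfolding p_def by (subst lead_coeff_prod) simp
    then show ?thesis by (simp only: deg)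
  qed
  \<comment> \<open>Multiplying by the unitriangular \<open>U\<close> turns the powers of \<open>x i\<close> into the values of \<open>p j\<close>,
    which vanish above the diagonal.\<close>
  define U where "U = mat n n (\<lambda>(l, j). coeff (p j) l)"
  have V: "V \<in> carrier_mat n n" and U: "U \<in> carrier_mat n n" by (simp_all add: U_def V_def)
  have "det U = prod_list (diag_mat U)"
    by (rule det_upper_triangular[OF _ U]) (auto simp: upper_triangular_def U_def coeff_eq_0 deg)
  also have "diag_mat U = map (\<lambda>i. 1) [0..<n]" unfolding diag_mat_def by (auto simp: U_def lc)
  finally have detU: "det U = 1" by (simp add: map_replicate_const prod_list_replicate)
  have VU: "(V * U) $$ (i, j) = poly (p j) (x i)" if "i < n" "j < n" for i j
  proof -
    have "(V * U) $$ (i, j) = (\<Sum>l<n. coeff (p j) l * x i ^ l)"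
      using index_mult_mat_sum[OF V U that] that by (simp add: U_def V_def mult.commute)
    also have "\<dots> = (\<Sum>l\<le>j. coeff (p j) l * x i ^ l)"
      using that by (intro sum.mono_neutral_right) (auto simp: coeff_eq_0 deg)
    finally show ?thesis by (simp add: poly_altdef deg)
  qed
  have "det (V * U) = prod_list (diag_mat (V * U))"
  proof (rule det_lower_triangular[where n = n])
    fix i j :: nat assume ij: "i < j" "j < n"
    then have "poly (p j) (x i) = 0" by (auto simp: p_def poly_prod intro!: prod_zero)
    then show "(V * U) $$ (i, j) = 0" using VU[of i j] ij by simp
  qed (use U V in auto)
  also have "diag_mat (V * U) = map (\<lambda>j. poly (p j) (x j)) [0..<n]"
    unfolding diag_mat_def using VU V U by auto
  also have "prod_list \<dots> = (\<Prod>j<n. poly (p j) (x j))"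
    by (simp add: prod.distinct_set_conv_list[symmetric] atLeast0LessThan)
  also have "\<dots> = (\<Prod>j<n. \<Prod>l<j. x j - x l)"
    by (simp add: p_def poly_prod)
  finally show ?thesis using det_mult[OF V U] detU by (simp add: V_def)
qed

lemma det_scale_rows:
  fixes a :: "nat \<Rightarrow> 'a :: comm_ring_1"
  shows "det (mat n n (\<lambda>(i, j). a i * g i j)) = (\<Prod>i<n. a i) * det (mat n n (\<lambda>(i, j). g i j))"
proof -
  have "det (mat n n (\<lambda>(i, j). a i * g i j)) =
     (\<Sum>p\<in>{p. p permutes {0..<n}}. signof p * (\<Prod>i=0..<n. a i * g i (p i)))"
    by (subst det_def'[where n = n]) (auto intro!: sum.cong prod.cong simp: permutes_def)
  also have "\<dots> = (\<Prod>i<n. a i) * (\<Sum>p\<in>{p. p permutes {0..<n}}. signof p * (\<Prod>i=0..<n. g i (p i)))"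
    by (simp add: prod.distrib sum_distrib_left mult_ac atLeast0LessThan)
  also have "(\<Sum>p\<in>{p. p permutes {0..<n}}. signof p * (\<Prod>i=0..<n. g i (p i))) = det (mat n n (\<lambda>(i, j). g i j))"
    by (subst det_def'[where n = n]) (auto intro!: sum.cong prod.cong simp: permutes_def)
  finally show ?thesis .
qed

section \<open>Arithmetic progressions\<close>

lemma finite_mats:
  assumes "finite S"
  shows "finite {M \<in> carrier_mat n n. \<forall>i<n. \<forall>j<n. M $$ (i, j) \<in> S}" (is "finite ?T")
proof (rule finite_subset)
  let ?I = "{..<n} \<times> {..<n}"
  show "?T \<subseteq> mat n n ` (PiE ?I (\<lambda>_. S))"
  proof
    fix M assume M: "M \<in> ?T"
    have "M = mat n n (restrict (\<lambda>ij. M $$ ij) ?I)" using M by (intro eq_matI) auto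
    moreover have "restrict (\<lambda>ij. M $$ ij) ?I \<in> PiE ?I (\<lambda>_. S)" using M by auto
    ultimately show "M \<in> mat n n ` (PiE ?I (\<lambda>_. S))" by blast
  qed
  show "finite (mat n n ` (PiE ?I (\<lambda>_. S)))" using assms by (intro finite_imageI finite_PiE) auto
qed

lemma collision_of_finite_range:
  fixes f :: "nat \<Rightarrow> 'a"
  assumes "range f \<subseteq> S" "finite S"
  obtains i k where "k > 0" "f (i + k) = f i"
proof -
  have "\<not> inj f" using assms finite_subset range_inj_infinite by blast
  then obtain x y where "x < y" "f x = f y" by (metis injI linorder_neqE_nat)
  then show ?thesis by (intro that[of "y - x" x]) auto
qed

text \<open>By the pigeonhole principle two powers of \<open>A\<close> agree modulo
  \<open>q\<close>; multiplication by \<open>B ^\<^sub>m i\<close> cancels the smaller one.\<close>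

lemma pow_mat_cong_one_mod:
  fixes A :: "int mat" and q :: int
  assumes A: "A \<in> carrier_mat d d" and B: "B \<in> carrier_mat d d" "B * A = 1\<^sub>m d" and q: "q > 0"
  obtains N E where "N > 0" "E \<in> carrier_mat d d" "A ^\<^sub>m N = 1\<^sub>m d + q \<cdot>\<^sub>m E"
proof -
  define f where "f m = mat d d (\<lambda>ij. (A ^\<^sub>m m) $$ ij mod q)" for m
  have range: "range f \<subseteq> {M \<in> carrier_mat d d. \<forall>i<d. \<forall>j<d. M $$ (i, j) \<in> {0..<q}}"
    using q by (auto simp: f_def)
  obtain i k where ik: "k > 0" "f (i + k) = f i"
    using collision_of_finite_range[OF range finite_mats] by blast
  define D where "D = mat d d (\<lambda>ij. ((A ^\<^sub>m (i + k)) $$ ij - (A ^\<^sub>m i) $$ ij) div q)"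
  have D: "D \<in> carrier_mat d d" by (simp add: D_def)
  have eq: "A ^\<^sub>m (i + k) = A ^\<^sub>m i + q \<cdot>\<^sub>m D"
  proof (rule eq_matI)
    fix r s assume "r < dim_row (A ^\<^sub>m i + q \<cdot>\<^sub>m D)" "s < dim_col (A ^\<^sub>m i + q \<cdot>\<^sub>m D)"
    then have rs: "r < d" "s < d" using D by auto
    have "(A ^\<^sub>m (i + k)) $$ (r, s) mod q = (A ^\<^sub>m i) $$ (r, s) mod q"
      using arg_cong[OF ik(2), of "\<lambda>M. M $$ (r, s)"] rs by (simp add: f_def)
    then have "q dvd (A ^\<^sub>m (i + k)) $$ (r, s) - (A ^\<^sub>m i) $$ (r, s)" by (rule mod_eq_dvd_iff[THEN iffD1])
    then have "q * (((A ^\<^sub>m (i + k)) $$ (r, s) - (A ^\<^sub>m i) $$ (r, s)) div q) =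
        (A ^\<^sub>m (i + k)) $$ (r, s) - (A ^\<^sub>m i) $$ (r, s)" by (rule dvd_mult_div_cancel)
    then show "(A ^\<^sub>m (i + k)) $$ (r, s) = (A ^\<^sub>m i + q \<cdot>\<^sub>m D) $$ (r, s)"
      using rs A D by (simp add: D_def)
  qed (use A D in auto)
  note BA = pow_mat_left_inverse[OF A B, of i]
  note P = pow_carrier_mat[OF A] and PB = pow_carrier_mat[OF B(1)]
  have "A ^\<^sub>m k = B ^\<^sub>m i * A ^\<^sub>m i * A ^\<^sub>m k" using A BA by simp
  also have "\<dots> = B ^\<^sub>m i * A ^\<^sub>m (i + k)"
    using A B(1) by (simp add: pow_mat_add[OF A] assoc_mult_mat[of _ d d _ d _ d])
  also have "\<dots> = B ^\<^sub>m i * A ^\<^sub>m i + B ^\<^sub>m i * (q \<cdot>\<^sub>m D)"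
    unfolding eq by (rule mult_add_distrib_mat[OF PB P smult_carrier_mat[OF D]])
  also have "\<dots> = 1\<^sub>m d + q \<cdot>\<^sub>m (B ^\<^sub>m i * D)"
    using BA mult_smult_distrib[OF PB D] by simp
  finally show ?thesis using mult_carrier_mat[OF PB D, of i] ik(1) by (intro that[of k "B ^\<^sub>m i * D"]) auto
qed

lemma pow_cong_one_mod:
  fixes E :: "int mat"
  assumes E: "E \<in> carrier_mat d d"
  shows "\<exists>F\<in>carrier_mat d d. (1\<^sub>m d + q \<cdot>\<^sub>m E) ^\<^sub>m j = 1\<^sub>m d + q \<cdot>\<^sub>m F"
proof (induction j)
  case 0
  have "(1\<^sub>m d + q \<cdot>\<^sub>m E) ^\<^sub>m 0 = 1\<^sub>m d + q \<cdot>\<^sub>m 0\<^sub>m d d" using E by (intro eq_matI) auto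
  then show ?case by (intro bexI[of _ "0\<^sub>m d d"]) auto
next
  case (Suc j)
  then obtain F where F: "F \<in> carrier_mat d d" "(1\<^sub>m d + q \<cdot>\<^sub>m E) ^\<^sub>m j = 1\<^sub>m d + q \<cdot>\<^sub>m F" by blast
  let ?T = "1\<^sub>m d + q \<cdot>\<^sub>m E"
  have T: "?T \<in> carrier_mat d d" using E by simp
  define G where "G = F * ?T"
  have G: "G \<in> carrier_mat d d" using F T by (simp add: G_def)
  have "?T ^\<^sub>m Suc j = (1\<^sub>m d + q \<cdot>\<^sub>m F) * ?T" using F by simp
  also have "\<dots> = 1\<^sub>m d * ?T + (q \<cdot>\<^sub>m F) * ?T"
    using F(1) T by (intro add_mult_distrib_mat) auto
  also have "(q \<cdot>\<^sub>m F) * ?T = q \<cdot>\<^sub>m G"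
    unfolding G_def using F(1) T by (rule mult_smult_assoc_mat)
  also have "1\<^sub>m d * ?T + q \<cdot>\<^sub>m G = 1\<^sub>m d + q \<cdot>\<^sub>m (E + G)"
    using E G T by (intro eq_matI) (auto simp: algebra_simps)
  finally show ?case using E G by (intro bexI[of _ "E + G"]) auto
qed

text \<open>With \<open>T = 1 + 4E\<close>, the difference of \<open>X T^k\<close> is
  \<open>X (T - 1) T^k = 4 X E T^k\<close>. Each difference yields a factor 4 and replaces
  \<open>X\<close> by \<open>X E\<close>, so the induction needs arbitrary \<open>X\<close>.\<close>

lemma flat_pow_mat:
  fixes X E :: "int mat"
  assumes X: "X \<in> carrier_mat d d" and E: "E \<in> carrier_mat d d" and ij: "i < d" "j < d"
  shows "flat (\<lambda>k. (X * (1\<^sub>m d + 4 \<cdot>\<^sub>m E) ^\<^sub>m k) $$ (i, j))"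
  unfolding flat_def
proof (intro allI)
  fix m k
  let ?T = "1\<^sub>m d + 4 \<cdot>\<^sub>m E"
  have T: "?T \<in> carrier_mat d d" using E by simp
  note P = pow_carrier_mat[OF T]
  show "4 ^ m dvd (fdiff ^^ m) (\<lambda>k. (X * ?T ^\<^sub>m k) $$ (i, j)) k" using X
  proof (induction m arbitrary: X k)
    case (Suc m)
    have "fdiff (\<lambda>k. (X * ?T ^\<^sub>m k) $$ (i, j)) k = 4 * (X * E * ?T ^\<^sub>m k) $$ (i, j)" for k
    proof -
      have "?T ^\<^sub>m Suc k = ?T * ?T ^\<^sub>m k" using pow_mat_commute[OF T, of 1 k] T by simp
      also have "\<dots> = ?T ^\<^sub>m k + 4 \<cdot>\<^sub>m (E * ?T ^\<^sub>m k)"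
        using E T P[of k] by (simp add: add_mult_distrib_mat[of _ d d _ _ d] mult_smult_assoc_mat[of _ d d _ d])
      finally have "X * ?T ^\<^sub>m Suc k = X * ?T ^\<^sub>m k + X * (4 \<cdot>\<^sub>m (E * ?T ^\<^sub>m k))"
        using Suc.prems E P[of k] by (simp add: mult_add_distrib_mat[of _ d d _ d])
      also have "X * (4 \<cdot>\<^sub>m (E * ?T ^\<^sub>m k)) = 4 \<cdot>\<^sub>m (X * E * ?T ^\<^sub>m k)"
        using Suc.prems E P[of k] by (simp add: mult_smult_distrib[of _ d d _ d] assoc_mult_mat[of _ d d _ d _ d])
      finally have "X * ?T ^\<^sub>m Suc k = X * ?T ^\<^sub>m k + 4 \<cdot>\<^sub>m (X * E * ?T ^\<^sub>m k)" .
      moreover define Z where "Z = X * E * ?T ^\<^sub>m k"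
      moreover have "Z \<in> carrier_mat d d"
        unfolding Z_def by (rule mult_carrier_mat[OF mult_carrier_mat[OF Suc.prems E] P])
      ultimately have "X * ?T ^\<^sub>m Suc k = X * ?T ^\<^sub>m k + 4 \<cdot>\<^sub>m Z" "Z \<in> carrier_mat d d" by simp_all
      then have "(X * ?T ^\<^sub>m Suc k) $$ (i, j) = (X * ?T ^\<^sub>m k) $$ (i, j) + 4 * Z $$ (i, j)"
        using ij by (simp del: pow_mat.simps index_mult_mat(1))
      then show ?thesis by (simp only: fdiff_def Z_def add_diff_cancel_left')
    qed
    then have "fdiff (\<lambda>k. (X * ?T ^\<^sub>m k) $$ (i, j)) = (\<lambda>k. 4 * (X * E * ?T ^\<^sub>m k) $$ (i, j))"
      by (rule ext)
    then have "(fdiff ^^ Suc m) (\<lambda>k. (X * ?T ^\<^sub>m k) $$ (i, j)) k =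
        4 * (fdiff ^^ m) (\<lambda>k. (X * E * ?T ^\<^sub>m k) $$ (i, j)) k"
      by (simp add: fdiff_pow_Suc fdiff_pow_cmult del: funpow.simps(2))
    moreover have "4 ^ m dvd (fdiff ^^ m) (\<lambda>k. (X * E * ?T ^\<^sub>m k) $$ (i, j)) k"
      using Suc.prems E by (intro Suc.IH) auto
    ultimately show ?case by simp
  qed simp
qed

text \<open>Splitting the exponent \<open>(a + N k) j\<close> shows column \<open>j\<close> as the
  first column of \<open>A^(a j) (A^(N j))^k\<close>, where \<open>A^(N j)\<close> is still the
  identity modulo 4. The determinant is a polynomial in these flat entries.\<close>

lemma flat_det_krylov:
  fixes A :: "int mat"
  assumes A: "A \<in> carrier_mat d d" and E: "E \<in> carrier_mat d d" "A ^\<^sub>m N = 1\<^sub>m d + 4 \<cdot>\<^sub>m E"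
  shows "flat (\<lambda>k. det (krylov_mat d (A ^\<^sub>m (a + N * k))))"
proof -
  note P = pow_carrier_mat[OF A]
  have entry: "flat (\<lambda>k. krylov_mat d (A ^\<^sub>m (a + N * k)) $$ (i, j))" if ij: "i < d" "j < d" for i j
  proof -
    obtain F where F: "F \<in> carrier_mat d d" "(A ^\<^sub>m N) ^\<^sub>m j = 1\<^sub>m d + 4 \<cdot>\<^sub>m F"
      using pow_cong_one_mod[OF E(1)] E(2) by metis
    have "(A ^\<^sub>m (a + N * k)) ^\<^sub>m j = A ^\<^sub>m (a * j) * (1\<^sub>m d + 4 \<cdot>\<^sub>m F) ^\<^sub>m k" for k
    proof -
      have "(A ^\<^sub>m (a + N * k)) ^\<^sub>m j = A ^\<^sub>m (a * j + N * j * k)"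
        by (subst pow_mat_mult[OF A, symmetric]) (simp add: algebra_simps)
      also have "\<dots> = A ^\<^sub>m (a * j) * A ^\<^sub>m (N * j * k)" by (rule pow_mat_add[OF A])
      also have "A ^\<^sub>m (N * j * k) = ((A ^\<^sub>m N) ^\<^sub>m j) ^\<^sub>m k" by (simp only: pow_mat_mult[OF A])
      finally show ?thesis by (simp only: F(2))
    qed
    then have "krylov_mat d (A ^\<^sub>m (a + N * k)) $$ (i, j) = (A ^\<^sub>m (a * j) * (1\<^sub>m d + 4 \<cdot>\<^sub>m F) ^\<^sub>m k) $$ (i, 0)" for k
      using ij by (simp add: krylov_mat_def)
    with flat_pow_mat[OF P F(1), of i 0 "a * j"] ij show ?thesis by simp
  qed
  have K: "krylov_mat d X \<in> carrier_mat d d" for X :: "int mat" by (simp add: krylov_mat_def)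
  show ?thesis
    unfolding det_def'[OF K]
    by (intro flat_sum flat_mult flat_const flat_prod entry) (auto simp: permutes_def)
qed

lemma infinite_vimage_progression:
  assumes S: "infinite S" and N: "(N :: nat) > 0"
  obtains a where "infinite {k. a + N * k \<in> S}"
proof -
  have "(\<lambda>n. n mod N) ` S \<subseteq> {..<N}" by (intro image_subsetI) (simp add: N)
  then have "finite ((\<lambda>n. n mod N) ` S)" by (rule finite_subset) simp
  from pigeonhole_infinite[OF S this] obtain x where x: "infinite {n \<in> S. n mod N = x mod N}"
    by (elim bexE)
  have "{n \<in> S. n mod N = x mod N} \<subseteq> (\<lambda>k. x mod N + N * k) ` {k. x mod N + N * k \<in> S}"
  proof
    fix n assume n: "n \<in> {n \<in> S. n mod N = x mod N}"
    then have nS: "n \<in> S" "x mod N = n mod N" by auto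
    have "x mod N + N * (n div N) = n" unfolding nS(2) by simp
    with nS(1) show "n \<in> (\<lambda>k. x mod N + N * k) ` {k. x mod N + N * k \<in> S}"
      by (intro image_eqI[of _ _ "n div N"]) simp_all
  qed
  note sub = this
  show ?thesis
  proof (rule that, rule notI)
    assume "finite {k. x mod N + N * k \<in> S}"
    from finite_subset[OF sub finite_imageI[OF this]] x show False by simp
  qed
qed

lemma flat_infinite_eq:
  assumes f: "flat f" and inf: "infinite {k. f k = c}"
  shows "f k = c"
proof -
  have "flat (\<lambda>k. f k + (- c))" using f by (intro flat_add flat_const)
  moreover have "infinite {k. f k + (- c) = 0}" using inf by (simp add: eq_iff_diff_eq_0[symmetric])
  ultimately have "f k + (- c) = 0" by (rule flat_infinite_zeros)
  then show ?thesis by simp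
qed

text \<open>\<open>N\<close> makes \<open>A ^\<^sub>m N\<close> the identity modulo 4. Some residue
  class \<open>a\<close> modulo \<open>N\<close>, and then one of the two signs, occurs infinitely
  often; a flat sequence taking a value infinitely often is constant.\<close>

lemma det_krylov_progression:
  fixes A :: "int mat"
  assumes A: "A \<in> carrier_mat d d" and B: "B \<in> carrier_mat d d" "B * A = 1\<^sub>m d"
    and inf: "infinite {n. \<bar>det (krylov_mat d (A ^\<^sub>m n))\<bar> = 1}"
  obtains a N where "N > 0" "\<And>k. \<bar>det (krylov_mat d (A ^\<^sub>m (a + N * k)))\<bar> = 1"
proof -
  obtain N E where E: "N > 0" "E \<in> carrier_mat d d" "A ^\<^sub>m N = 1\<^sub>m d + 4 \<cdot>\<^sub>m E"
    using pow_mat_cong_one_mod[OF A B, of 4] by auto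
  obtain a where a: "infinite {k. \<bar>det (krylov_mat d (A ^\<^sub>m (a + N * k)))\<bar> = 1}"
    using infinite_vimage_progression[OF inf E(1)] by auto
  let ?f = "\<lambda>k. det (krylov_mat d (A ^\<^sub>m (a + N * k)))"
  have "{k. \<bar>?f k\<bar> = 1} = {k. ?f k = 1} \<union> {k. ?f k = - 1}" by auto
  with a have "infinite {k. ?f k = 1} \<or> infinite {k. ?f k = - 1}" by simp
  then obtain c where c: "infinite {k. ?f k = c}" "\<bar>c\<bar> = 1" by force
  have "?f k = c" for k using flat_det_krylov[OF A E(2,3)] c(1) by (rule flat_infinite_eq)
  with c(2) show ?thesis by (intro that[OF E(1), of a]) simp
qed

section \<open>Growth of Vandermonde products\<close>

lemma norm_cis_minus_one_le: "norm (cis x - 1) \<le> \<bar>x\<bar>"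
proof -
  have "norm (cis x - 1) = 2 * \<bar>sin (x / 2)\<bar>"
    using dist_exp_i_1[of x] by (simp add: cis_conv_exp mult.commute)
  also have "\<dots> \<le> 2 * \<bar>x / 2\<bar>" by (intro mult_left_mono abs_sin_x_le_abs_x) auto
  finally show ?thesis by simp
qed

lemma simultaneous_recurrence:
  fixes z :: "nat \<Rightarrow> complex"
  assumes z: "\<And>i. i < d \<Longrightarrow> norm (z i) = 1" and \<delta>: "\<delta> > 0"
  obtains k where "k \<ge> m" "\<And>i. i < d \<Longrightarrow> norm (z i ^ k - 1) < \<delta>"
proof -
  define m' where "m' = Suc m"
  \<comment> \<open>Passing from \<open>q\<close> to its multiple \<open>q m'\<close> ensures
    \<open>k \<ge> m\<close> but magnifies the Dirichlet error by \<open>m'\<close>;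
    \<open>N\<close> absorbs this and the factor \<open>2 * pi\<close>.\<close>
  obtain N :: nat where N: "2 * pi * m' / \<delta> < N" using reals_Archimedean2 by blast
  have "0 \<le> 2 * pi * m' / \<delta>" using \<delta> by simp
  with N have N0: "N > 0" by (metis of_nat_0_less_iff order_le_less_trans)
  define \<theta> where "\<theta> i = Arg (z i) / (2 * pi)" for i
  obtain q :: int and p where q: "0 < q" and qp: "\<And>i. i < d \<Longrightarrow> \<bar>of_int q * \<theta> i - of_int (p i)\<bar> < 1 / N"
    using Dirichlet_approx_simult[OF N0, of d \<theta>] by metis
  define k where "k = nat q * m'"
  have zi: "z i = cis (2 * pi * \<theta> i)" if "i < d" for i
  proof -
    have "z i \<noteq> 0" "sgn (z i) = z i" using z[OF that] by (auto simp: sgn_div_norm)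
    then show ?thesis using cis_Arg[of "z i"] by (simp add: \<theta>_def)
  qed
  have near: "norm (z i ^ k - 1) < \<delta>" if i: "i < d" for i
  proof -
    have "z i ^ k = cis (2 * pi * (m' * (q * \<theta> i - p i)))"
    proof -
      have "z i ^ k = cis (2 * pi * (m' * (q * \<theta> i)))"
      proof -
        have "real k * (2 * pi * \<theta> i) = 2 * pi * (m' * (q * \<theta> i))" using q by (simp add: k_def)
        moreover have "z i ^ k = cis (real k * (2 * pi * \<theta> i))" unfolding zi[OF i] by (rule Complex.DeMoivre)
        ultimately show ?thesis by (simp only:)
      qed
      also have "\<dots> = cis (2 * pi * (m' * (q * \<theta> i - p i))) * cis (2 * pi * of_int (int m' * p i))"
        by (simp add: cis_mult algebra_simps)
      also have "cis (2 * pi * of_int (int m' * p i)) = 1" by (rule cis_multiple_2pi) simp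
      finally show ?thesis by simp
    qed
    then have "norm (z i ^ k - 1) \<le> \<bar>2 * pi * (m' * (q * \<theta> i - p i))\<bar>"
      by (simp only: norm_cis_minus_one_le)
    also have "\<dots> = 2 * pi * m' * \<bar>q * \<theta> i - p i\<bar>" by (simp add: abs_mult)
    also have "\<dots> < 2 * pi * m' * (1 / N)"
      using qp[OF i] by (intro mult_strict_left_mono) (auto simp: m'_def)
    also have "\<dots> < \<delta>" using N N0 \<delta> by (simp add: field_simps)
    finally show ?thesis .
  qed
  have km: "k \<ge> m"
  proof -
    have "1 * m' \<le> nat q * m'" using q by (intro mult_le_mono1) simp
    then show ?thesis by (simp add: k_def m'_def)
  qed
  show ?thesis using km near by (rule that)
qed

lemma recurrence_sequence:
  fixes z :: "nat \<Rightarrow> complex"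
  assumes z: "\<And>i. i < d \<Longrightarrow> norm (z i) = 1"
  obtains k :: "nat \<Rightarrow> nat" where "filterlim k at_top sequentially"
    and "\<And>i. i < d \<Longrightarrow> (\<lambda>t. z i ^ k t) \<longlonglongrightarrow> 1"
proof -
  have "\<exists>k. k \<ge> t \<and> (\<forall>i<d. norm (z i ^ k - 1) < 1 / Suc t)" for t
  proof (rule simultaneous_recurrence[of d z "1 / real (Suc t)" t])
    fix k assume k: "k \<ge> t" "\<And>i. i < d \<Longrightarrow> norm (z i ^ k - 1) < 1 / real (Suc t)"
    show ?thesis using k by (intro exI[of _ k]) simp
  qed (use z in simp_all)
  then obtain k where k: "\<And>t. k t \<ge> t" "\<And>t i. i < d \<Longrightarrow> norm (z i ^ k t - 1) < 1 / Suc t" by metis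
  have "filterlim k at_top sequentially"
    using k(1) by (intro filterlim_at_top_mono[OF filterlim_ident]) auto
  moreover have "(\<lambda>t. z i ^ k t) \<longlonglongrightarrow> 1" if "i < d" for i
  proof -
    have "(\<lambda>t. z i ^ k t - 1) \<longlonglongrightarrow> 0"
    proof (rule Lim_null_comparison)
      show "\<forall>\<^sub>F t in sequentially. norm (z i ^ k t - 1) \<le> 1 / real (Suc t)"
        using k(2)[OF that] by (intro always_eventually allI less_imp_le)
      show "(\<lambda>t. 1 / real (Suc t)) \<longlonglongrightarrow> 0" by (rule lim_1_over_n[THEN LIMSEQ_Suc])
    qed
    then show ?thesis by (simp add: LIM_zero_iff)
  qed
  ultimately show ?thesis by (rule that)
qed

text \<open>Requiring positive limits makes the alternative stable under products: a zero limit
  against a divergent factor would be undecided.\<close>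

lemma prod_tendsto_pos_or_at_top:
  fixes h :: "'b \<Rightarrow> 'a \<Rightarrow> real"
  assumes "finite P" "\<And>p. p \<in> P \<Longrightarrow> (\<exists>L>0. (h p \<longlongrightarrow> L) F) \<or> filterlim (h p) at_top F"
  shows "(\<exists>L>0. ((\<lambda>t. \<Prod>p\<in>P. h p t) \<longlongrightarrow> L) F) \<or> filterlim (\<lambda>t. \<Prod>p\<in>P. h p t) at_top F"
  using assms
proof (induction P)
  case empty
  show ?case by (auto intro: exI[of _ 1])
next
  case (insert p P)
  let ?g = "\<lambda>t. \<Prod>p\<in>P. h p t"
  have eq: "(\<lambda>t. \<Prod>p\<in>insert p P. h p t) = (\<lambda>t. h p t * ?g t)" using insert.hyps by simp
  have "(\<exists>L>0. (h p \<longlongrightarrow> L) F) \<or> filterlim (h p) at_top F" using insert.prems by blast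
  moreover have "(\<exists>L>0. (?g \<longlongrightarrow> L) F) \<or> filterlim ?g at_top F" using insert.IH insert.prems by blast
  ultimately show ?case
    unfolding eq
  proof (elim disjE exE conjE)
    fix L L' assume "L > 0" "(h p \<longlongrightarrow> L) F" "L' > 0" "(?g \<longlongrightarrow> L') F"
    then show "(\<exists>L>0. ((\<lambda>t. h p t * ?g t) \<longlongrightarrow> L) F) \<or> filterlim (\<lambda>t. h p t * ?g t) at_top F"
      by (intro disjI1 exI[of _ "L * L'"] conjI tendsto_mult) simp_all
  next
    fix L assume L: "L > 0" "(h p \<longlongrightarrow> L) F" "filterlim ?g at_top F"
    have "filterlim (\<lambda>t. h p t * ?g t) at_top F" by (rule filterlim_tendsto_pos_mult_at_top[OF L(2,1,3)])
    then show "(\<exists>L>0. ((\<lambda>t. h p t * ?g t) \<longlongrightarrow> L) F) \<or> filterlim (\<lambda>t. h p t * ?g t) at_top F" ..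
  next
    fix L assume L: "L > 0" "(?g \<longlongrightarrow> L) F" "filterlim (h p) at_top F"
    have "filterlim (\<lambda>t. ?g t * h p t) at_top F" by (rule filterlim_tendsto_pos_mult_at_top[OF L(2,1,3)])
    then show "(\<exists>L>0. ((\<lambda>t. h p t * ?g t) \<longlongrightarrow> L) F) \<or> filterlim (\<lambda>t. h p t * ?g t) at_top F"
      by (simp add: mult.commute)
  next
    assume "filterlim (h p) at_top F" "filterlim ?g at_top F"
    then have "filterlim (\<lambda>t. h p t * ?g t) at_top F" by (rule filterlim_at_top_mult_at_top)
    then show "(\<exists>L>0. ((\<lambda>t. h p t * ?g t) \<longlongrightarrow> L) F) \<or> filterlim (\<lambda>t. h p t * ?g t) at_top F" ..
  qed
qed

lemma prod_at_top:
  fixes h :: "'b \<Rightarrow> 'a \<Rightarrow> real"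
  assumes "finite P" "\<And>p. p \<in> P \<Longrightarrow> (\<exists>L>0. (h p \<longlongrightarrow> L) F) \<or> filterlim (h p) at_top F"
    and "q \<in> P" "filterlim (h q) at_top F"
  shows "filterlim (\<lambda>t. \<Prod>p\<in>P. h p t) at_top F"
proof -
  let ?g = "\<lambda>t. \<Prod>p\<in>P - {q}. h p t"
  have eq: "(\<lambda>t. \<Prod>p\<in>P. h p t) = (\<lambda>t. ?g t * h q t)"
    using assms by (subst prod.remove[of P q]) (auto simp: mult.commute)
  have "(\<exists>L>0. (?g \<longlongrightarrow> L) F) \<or> filterlim ?g at_top F"
    using assms by (intro prod_tendsto_pos_or_at_top) auto
  then have "filterlim (\<lambda>t. ?g t * h q t) at_top F"
  proof (elim disjE exE conjE)
    fix L assume L: "L > 0" "(?g \<longlongrightarrow> L) F"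
    show "filterlim (\<lambda>t. ?g t * h q t) at_top F" by (rule filterlim_tendsto_pos_mult_at_top[OF L(2,1) assms(4)])
  next
    assume "filterlim ?g at_top F"
    then show "filterlim (\<lambda>t. ?g t * h q t) at_top F" using assms(4) by (rule filterlim_at_top_mult_at_top)
  qed
  with eq show ?thesis by simp
qed

text \<open>Each index occurs in exactly \<open>d - 1\<close> of the pairs.\<close>

lemma prod_pairs_mult:
  fixes r :: "nat \<Rightarrow> 'a :: comm_monoid_mult"
  shows "(\<Prod>j<d. \<Prod>l<j. r j * r l) = (\<Prod>i<d. r i) ^ (d - 1)"
proof (induction d)
  case (Suc d)
  have "(\<Prod>j<Suc d. \<Prod>l<j. r j * r l) = (\<Prod>i<d. r i) ^ (d - 1) * (\<Prod>l<d. r d * r l)"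
    by (simp only: prod.lessThan_Suc Suc)
  also have "(\<Prod>l<d. r d * r l) = r d ^ d * (\<Prod>l<d. r l)" by (simp add: prod.distrib)
  also have "(\<Prod>i<d. r i) ^ (d - 1) * (r d ^ d * (\<Prod>l<d. r l)) = (\<Prod>i<Suc d. r i) ^ (Suc d - 1)"
    by (cases d) (simp_all add: power_mult_distrib mult_ac)
  finally show ?case .
qed simp

text \<open>The denominator makes the gap invariant under common scaling of \<open>u\<close> and
  \<open>v\<close>. Over all pairs of eigenvalues the denominators multiply to 1, because the moduli
  do, and the square of the Vandermonde product remains.\<close>

definition pair_gap :: "complex \<Rightarrow> complex \<Rightarrow> nat \<Rightarrow> real" where
  "pair_gap u v n = (norm (u ^ n - v ^ n))\<^sup>2 / (norm u * norm v) ^ n"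

lemma pair_gap_sym: "pair_gap u v n = pair_gap v u n"
  by (simp add: pair_gap_def norm_minus_commute mult.commute)

text \<open>With \<open>x\<close> and \<open>y\<close> the moduli of the two powers, the gap is at
  least \<open>(x - y)^2 / (x y) = x / y - 2 + y / x\<close>, where \<open>x / y\<close> grows
  geometrically.\<close>

lemma pair_gap_at_top:
  assumes "norm u > norm v" "v \<noteq> 0" and f: "filterlim f at_top F"
  shows "filterlim (\<lambda>t. pair_gap u v (f t)) at_top F"
proof -
  define \<rho> where "\<rho> = norm u / norm v"
  have \<rho>: "\<rho> > 1" using assms by (simp add: \<rho>_def)
  have u: "norm u > 0" using assms by (metis norm_ge_zero order_le_less_trans)
  have lower: "pair_gap u v n \<ge> \<rho> ^ n + - 2" for n
  proof -
    define x y where "x = norm u ^ n" and "y = norm v ^ n"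
    have xy: "x > 0" "y > 0" using u assms by (simp_all add: x_def y_def)
    have "\<bar>x - y\<bar> \<le> norm (u ^ n - v ^ n)"
      using norm_triangle_ineq3[of "u ^ n" "v ^ n"] by (simp add: norm_power x_def y_def)
    then have "(x - y)\<^sup>2 \<le> (norm (u ^ n - v ^ n))\<^sup>2" by (metis abs_le_square_iff abs_norm_cancel)
    then have "(x - y)\<^sup>2 / (x * y) \<le> pair_gap u v n"
      using xy by (simp add: pair_gap_def power_mult_distrib x_def y_def divide_right_mono)
    moreover have "(x - y)\<^sup>2 / (x * y) = x / y - 2 + y / x"
      using xy by (simp add: field_simps power2_eq_square)
    moreover have "y / x > 0" using xy by simp
    ultimately show ?thesis by (simp add: \<rho>_def x_def y_def power_divide)
  qed
  have "filterlim (\<lambda>t. \<rho> ^ f t + - 2) at_top F"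
  proof -
    have "filterlim (\<lambda>n. \<rho> ^ n) at_top sequentially"
      using filterlim_realpow_sequentially_gt1[of \<rho>] \<rho>
      by (intro filterlim_at_infinity_imp_filterlim_at_top) (auto intro!: always_eventually)
    then have "filterlim (\<lambda>t. \<rho> ^ f t) at_top F" using f by (rule filterlim_compose)
    then show ?thesis
      using filterlim_tendsto_add_at_top[OF tendsto_const[of "-2"]] by (simp add: add.commute)
  qed
  then show ?thesis by (rule filterlim_at_top_mono) (intro always_eventually allI lower)
qed

text \<open>The common modulus cancels, and the normalized \<open>(N * k t)\<close>-th powers tend
  to 1. What remains is the gap at \<open>a\<close>, positive since
  \<open>u ^ a \<noteq> v ^ a\<close>.\<close>

lemma pair_gap_tendsto:
  fixes u v :: complex
  assumes uv: "norm u = norm v" "v \<noteq> 0" and ne: "u ^ a \<noteq> v ^ a"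
    and lim: "(\<lambda>t. ((u / norm u) ^ N) ^ k t) \<longlonglongrightarrow> 1" "(\<lambda>t. ((v / norm v) ^ N) ^ k t) \<longlonglongrightarrow> 1"
  shows "\<exists>L>0. (\<lambda>t. pair_gap u v (a + N * k t)) \<longlonglongrightarrow> L"
proof -
  define r where "r = norm v"
  have r: "r > 0" "norm u = r" using uv by (simp_all add: r_def)
  let ?\<zeta> = "\<lambda>w t. ((w / of_real r) ^ N) ^ k t"
  have split: "w ^ (a + N * k t) = of_real (r ^ (N * k t)) * (w ^ a * ?\<zeta> w t)" for w :: complex and t
    using r by (simp add: power_add power_mult power_divide field_simps)
  have "pair_gap u v (a + N * k t) = (norm (u ^ a * ?\<zeta> u t - v ^ a * ?\<zeta> v t))\<^sup>2 / r ^ (2 * a)" for t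
  proof -
    have "u ^ (a + N * k t) - v ^ (a + N * k t) = of_real (r ^ (N * k t)) * (u ^ a * ?\<zeta> u t - v ^ a * ?\<zeta> v t)"
      unfolding split by (simp add: algebra_simps)
    then have "norm (u ^ (a + N * k t) - v ^ (a + N * k t)) = r ^ (N * k t) * norm (u ^ a * ?\<zeta> u t - v ^ a * ?\<zeta> v t)"
      using r by (simp add: norm_mult norm_power)
    moreover have "(norm u * norm v) ^ (a + N * k t) = r ^ (2 * a) * (r ^ (N * k t))\<^sup>2"
      using r uv by (simp add: power_add power_mult power2_eq_square power_mult_distrib algebra_simps)
    ultimately show ?thesis
      using r by (simp add: pair_gap_def power_mult_distrib)
  qed
  moreover have "(\<lambda>t. (norm (u ^ a * ?\<zeta> u t - v ^ a * ?\<zeta> v t))\<^sup>2 / r ^ (2 * a)) \<longlonglongrightarrow>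
      (norm (u ^ a * 1 - v ^ a * 1))\<^sup>2 / r ^ (2 * a)"
    using lim r uv by (intro tendsto_intros) auto
  ultimately show ?thesis using ne r by (intro exI[of _ "(norm (u ^ a * 1 - v ^ a * 1))\<^sup>2 / r ^ (2 * a)"]) auto
qed

lemma not_constant_prod_pairs:
  fixes \<kappa> :: "nat \<Rightarrow> complex"
  assumes prod1: "(\<Prod>i<d. norm (\<kappa> i)) = 1" and off: "i0 < d" "norm (\<kappa> i0) \<noteq> 1" and N: "N > 0" and c: "c > 0"
    and const: "\<And>k. (\<Prod>j<d. \<Prod>l<j. norm (\<kappa> j ^ (a + N * k) - \<kappa> l ^ (a + N * k))) = c"
  shows False
proof -
  have nz: "\<kappa> i \<noteq> 0" if "i < d" for i
  proof
    assume "\<kappa> i = 0"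
    then have "(\<Prod>i<d. norm (\<kappa> i)) = 0" using that by (intro prod_zero) auto
    with prod1 show False by simp
  qed
  define P where "P = (SIGMA j:{..<d}. {..<j})"
  have P: "finite P" "\<And>j l. (j, l) \<in> P \<longleftrightarrow> l < j \<and> j < d" by (auto simp: P_def)
  have pairs: "(\<Prod>j<d. \<Prod>l<j. g j l) = (\<Prod>(j, l)\<in>P. g j l)" for g :: "nat \<Rightarrow> nat \<Rightarrow> real"
    unfolding P_def by (rule prod.Sigma) auto
  \<comment> \<open>The product is nonzero at \<open>k = 0\<close>, so no two \<open>a\<close>-th
    powers coincide; this keeps the limits for pairs of equal modulus positive.\<close>
  have distinct: "\<kappa> j ^ a \<noteq> \<kappa> l ^ a" if "(j, l) \<in> P" for j l
  proof
    assume "\<kappa> j ^ a = \<kappa> l ^ a"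
    then have "(\<Prod>(j, l)\<in>P. norm (\<kappa> j ^ (a + N * 0) - \<kappa> l ^ (a + N * 0))) = 0"
      using P(1) that by (intro prod_zero bexI[of _ "(j, l)"]) auto
    with const[of 0] c show False by (simp add: pairs)
  qed
  obtain k where k: "filterlim k at_top sequentially"
    "\<And>i. i < d \<Longrightarrow> (\<lambda>t. ((\<kappa> i / norm (\<kappa> i)) ^ N) ^ k t) \<longlonglongrightarrow> 1"
    using recurrence_sequence[of d "\<lambda>i. (\<kappa> i / norm (\<kappa> i)) ^ N"] nz
    by (auto simp: norm_power norm_divide)
  define n where "n t = a + N * k t" for t
  have n: "filterlim n at_top sequentially"
    using N by (intro filterlim_at_top_mono[OF k(1)] always_eventually) (auto simp: n_def intro: trans_le_add2)
  define h where "h = (\<lambda>(j, l) t. pair_gap (\<kappa> j) (\<kappa> l) (n t))"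
  have top: "filterlim (h (j, l)) at_top sequentially" if "(j, l) \<in> P" "norm (\<kappa> j) \<noteq> norm (\<kappa> l)" for j l
    using that P(2) nz[of j] nz[of l] pair_gap_at_top[OF _ _ n, of "\<kappa> j" "\<kappa> l"] pair_gap_at_top[OF _ _ n, of "\<kappa> l" "\<kappa> j"]
    by (cases "norm (\<kappa> j) < norm (\<kappa> l)") (auto simp: h_def pair_gap_sym[of "\<kappa> j" "\<kappa> l"])
  have alt: "(\<exists>L>0. h p \<longlonglongrightarrow> L) \<or> filterlim (h p) at_top sequentially" if "p \<in> P" for p
  proof -
    obtain j l where p: "p = (j, l)" by fastforce
    show ?thesis
    proof (cases "norm (\<kappa> j) = norm (\<kappa> l)")
      case True
      have "l < d" "j < d" using that P(2) p by auto
      then show ?thesis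
        using pair_gap_tendsto[OF True nz distinct k(2) k(2)] that p by (simp add: h_def n_def)
    qed (use top that p in auto)
  qed
  \<comment> \<open>If all moduli were equal they would be 1, as their product is, contrary to
    \<open>off\<close>. So some pair has different moduli, and its gap diverges.\<close>
  have "\<exists>i<d. norm (\<kappa> i) \<noteq> norm (\<kappa> i0)"
  proof (rule ccontr)
    assume "\<not> ?thesis"
    then have "(\<Prod>i<d. norm (\<kappa> i)) = norm (\<kappa> i0) ^ d" by simp
    with prod1 off show False using power_eq_1_iff[of "norm (\<kappa> i0)" d] by simp
  qed
  then obtain i1 where i1: "i1 < d" "norm (\<kappa> i1) \<noteq> norm (\<kappa> i0)" by blast
  then consider "i0 < i1" | "i1 < i0" by (metis linorder_neqE_nat)
  then obtain q where q: "q \<in> P" "filterlim (h q) at_top sequentially"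
  proof cases
    case 1 with i1 top[of i1 i0] P(2) show ?thesis by (intro that[of "(i1, i0)"]) auto
  next
    case 2 with i1 off top[of i0 i1] P(2) show ?thesis by (intro that[of "(i0, i1)"]) auto
  qed
  have "(\<Prod>p\<in>P. h p t) = c\<^sup>2" for t
  proof -
    have "(\<Prod>(j, l)\<in>P. norm (\<kappa> j) * norm (\<kappa> l)) = 1"
      using prod_pairs_mult[of "\<lambda>i. norm (\<kappa> i)" d] by (simp add: pairs[symmetric] prod1)
    moreover have "(\<Prod>p\<in>P. h p t) = (\<Prod>(j, l)\<in>P. norm (\<kappa> j ^ n t - \<kappa> l ^ n t))\<^sup>2 / (\<Prod>(j, l)\<in>P. norm (\<kappa> j) * norm (\<kappa> l)) ^ n t"
      by (simp add: h_def pair_gap_def case_prod_unfold prod_dividef prod_power_distrib)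
    moreover have "(\<Prod>(j, l)\<in>P. norm (\<kappa> j ^ n t - \<kappa> l ^ n t)) = c"
      using const[of "k t"] by (simp add: pairs n_def)
    ultimately show ?thesis by simp
  qed
  moreover have "filterlim (\<lambda>t. \<Prod>p\<in>P. h p t) at_top sequentially"
    using P(1) alt q by (rule prod_at_top)
  ultimately have "filterlim (\<lambda>t::nat. c\<^sup>2) at_top sequentially" by simp
  then show False using not_tendsto_and_filterlim_at_infinity[OF _ tendsto_const] filterlim_at_top_imp_at_infinity trivial_limit_sequentially by blast
qed

section \<open>Powers conjugate to companion matrices\<close>

text \<open>Only finitely many integer matrices have entries bounded by \<open>T\<close>, so two
  powers coincide, and \<open>A\<close> is invertible.\<close>

lemma bounded_powers_finite_order:
  fixes A :: "int mat"
  assumes A: "A \<in> carrier_mat d d" and B: "B \<in> carrier_mat d d" "B * A = 1\<^sub>m d"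
    and bound: "\<And>m i j. i < d \<Longrightarrow> j < d \<Longrightarrow> \<bar>real_of_int ((A ^\<^sub>m m) $$ (i, j))\<bar> \<le> T"
  shows "\<exists>k>0. A ^\<^sub>m k = 1\<^sub>m d"
proof -
  have "(A ^\<^sub>m m) $$ (i, j) \<in> {- \<lfloor>T\<rfloor>..\<lfloor>T\<rfloor>}" if "i < d" "j < d" for m i j
  proof -
    have "\<bar>(A ^\<^sub>m m) $$ (i, j)\<bar> \<le> \<lfloor>T\<rfloor>" using bound[OF that, of m] by (simp add: le_floor_iff)
    then show ?thesis by auto
  qed
  then have range: "range (\<lambda>m. A ^\<^sub>m m) \<subseteq> {M \<in> carrier_mat d d. \<forall>i<d. \<forall>j<d. M $$ (i, j) \<in> {- \<lfloor>T\<rfloor>..\<lfloor>T\<rfloor>}}"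
    using pow_carrier_mat[OF A] by blast
  obtain i k where ik: "k > 0" "A ^\<^sub>m (i + k) = A ^\<^sub>m i"
    using collision_of_finite_range[OF range finite_mats] by blast
  with pow_mat_eq_imp_one[OF A B ik(2)] show ?thesis by blast
qed

lemma abs_det_eq_1:
  fixes A B :: "int mat"
  assumes "A \<in> carrier_mat d d" "B \<in> carrier_mat d d" "B * A = 1\<^sub>m d"
  shows "\<bar>det A\<bar> = 1"
proof -
  have "det A * det B = 1" using det_mult[OF assms(2,1)] assms(3) by (simp add: mult.commute)
  then show ?thesis by (metis abs_1 abs_zmult_eq_1)
qed

lemma companion_power_finite:
  fixes A :: "int mat"
  assumes A: "A \<in> carrier_mat d d" and B: "B \<in> carrier_mat d d" "B * A = 1\<^sub>m d"
    and order: "\<And>k. k > 0 \<Longrightarrow> A ^\<^sub>m k \<noteq> 1\<^sub>m d"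
    and d: "d \<ge> 2" and m: "m \<ge> 2" and C: "companion_mat d (A ^\<^sub>m m)"
  shows "finite {n. conjugate_to_companion d (A ^\<^sub>m n)}"
proof (rule ccontr)
  assume inf: "infinite {n. conjugate_to_companion d (A ^\<^sub>m n)}"
  have "{n. conjugate_to_companion d (A ^\<^sub>m n)} \<subseteq> {n. \<bar>det (krylov_mat d (A ^\<^sub>m n))\<bar> = 1}"
    using det_krylov_unit[OF A C] by auto
  with inf have "infinite {n. \<bar>det (krylov_mat d (A ^\<^sub>m n))\<bar> = 1}" using finite_subset by blast
  from det_krylov_progression[OF A B this] obtain a N
    where N: "N > 0" and unit: "\<And>k. \<bar>det (krylov_mat d (A ^\<^sub>m (a + N * k)))\<bar> = 1" by metis
  from companion_power_diagonalizable[OF A C d m] obtain \<mu> \<kappa> :: "nat \<Rightarrow> complex"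
    where inj: "inj_on \<mu> {..<d}"
      and row: "\<And>i j n. j < d \<Longrightarrow> i < d \<Longrightarrow> (\<Sum>l<d. \<mu> i ^ l * of_int ((A ^\<^sub>m n) $$ (l, j))) = \<kappa> i ^ n * \<mu> i ^ j"
    by metis
  \<comment> \<open>The rows of \<open>W\<close> are left eigenvectors of \<open>A\<close>, so
    \<open>W\<close> diagonalizes all powers of \<open>A\<close> at once; it is invertible because
    the \<open>\<mu> i\<close> are distinct.\<close>
  define W where "W = mat d d (\<lambda>(i, j). \<mu> i ^ j)"
  have W: "W \<in> carrier_mat d d" by (simp add: W_def)
  have "\<mu> j \<noteq> \<mu> l" if "l < j" "j < d" for j l
    using inj_onD[OF inj, of j l] that by auto
  then have detW: "det W \<noteq> 0" unfolding W_def det_vandermonde by auto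
  let ?h = "map_mat (of_int :: int \<Rightarrow> complex)"
  have WP: "W * ?h (A ^\<^sub>m n) = mat d d (\<lambda>(i, j). \<kappa> i ^ n * \<mu> i ^ j)" for n
  proof (rule eq_matI)
    fix i j assume "i < dim_row (mat d d (\<lambda>(i, j). \<kappa> i ^ n * \<mu> i ^ j))" "j < dim_col (mat d d (\<lambda>(i, j). \<kappa> i ^ n * \<mu> i ^ j))"
    then have ij: "i < d" "j < d" by auto
    have hA: "?h (A ^\<^sub>m n) \<in> carrier_mat d d" using A by simp
    show "(W * ?h (A ^\<^sub>m n)) $$ (i, j) = mat d d (\<lambda>(i, j). \<kappa> i ^ n * \<mu> i ^ j) $$ (i, j)"
      unfolding index_mult_mat_sum[OF W hA ij]
      using row[of j i n] ij A by (simp add: W_def)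
  qed (use W A in auto)
  \<comment> \<open>Column \<open>j\<close> of the Krylov matrix is column 0 of
    \<open>A^(n j)\<close>, where the factor \<open>\<mu> i ^ 0\<close> is 1. So \<open>W\<close>
    turns it into the Vandermonde matrix of the \<open>\<kappa> i ^ n\<close>.\<close>
  have detK: "det W * of_int (det (krylov_mat d (A ^\<^sub>m n))) = (\<Prod>j<d. \<Prod>l<j. \<kappa> j ^ n - \<kappa> l ^ n)" for n
  proof -
    have K: "krylov_mat d (A ^\<^sub>m n) \<in> carrier_mat d d" by (simp add: krylov_mat_def)
    have hK: "?h (krylov_mat d (A ^\<^sub>m n)) \<in> carrier_mat d d" using K by simp
    have "W * ?h (krylov_mat d (A ^\<^sub>m n)) = mat d d (\<lambda>(i, j). (\<kappa> i ^ n) ^ j)"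
    proof (rule eq_matI)
      fix i j assume "i < dim_row (mat d d (\<lambda>(i, j). (\<kappa> i ^ n) ^ j))" "j < dim_col (mat d d (\<lambda>(i, j). (\<kappa> i ^ n) ^ j))"
      then have ij: "i < d" "j < d" by auto
      show "(W * ?h (krylov_mat d (A ^\<^sub>m n))) $$ (i, j) = mat d d (\<lambda>(i, j). (\<kappa> i ^ n) ^ j) $$ (i, j)"
        unfolding index_mult_mat_sum[OF W hK ij]
        using row[of 0 i "n * j"] ij by (simp add: W_def krylov_mat_def pow_mat_mult[OF A] power_mult)
    qed (use W K in auto)
    moreover have "det (?h (krylov_mat d (A ^\<^sub>m n))) = of_int (det (krylov_mat d (A ^\<^sub>m n)))"
      by (rule of_int_hom.hom_det)
    ultimately show ?thesis using det_mult[OF W hK] det_vandermonde[of d "\<lambda>i. \<kappa> i ^ n"] by simp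
  qed
  \<comment> \<open>\<open>W\<close> times \<open>A\<close> is \<open>W\<close> with row
    \<open>i\<close> scaled by \<open>\<kappa> i\<close>, so the product of the
    \<open>\<kappa> i\<close> is \<open>det A\<close>, which is 1 or -1.\<close>
  have prod1: "(\<Prod>i<d. norm (\<kappa> i)) = 1"
  proof -
    have hA: "?h A \<in> carrier_mat d d" using A by simp
    have "W * ?h A = mat d d (\<lambda>(i, j). \<kappa> i * \<mu> i ^ j)" using WP[of 1] A by simp
    then have "det W * of_int (det A) = (\<Prod>i<d. \<kappa> i) * det W"
      using det_mult[OF W hA] det_scale_rows[of d \<kappa> "\<lambda>i j. \<mu> i ^ j"] by (auto simp: W_def of_int_hom.hom_det)
    then have "(\<Prod>i<d. \<kappa> i) = of_int (det A)" using detW by simp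
    then have "norm (\<Prod>i<d. \<kappa> i) = of_int \<bar>det A\<bar>" by simp
    then show ?thesis using abs_det_eq_1[OF A B] by (simp add: prod_norm)
  qed
  \<comment> \<open>Otherwise diagonalization bounds the entries of all powers by the constant
    \<open>T\<close>, and \<open>A\<close> would have finite order.\<close>
  have "\<exists>i<d. norm (\<kappa> i) \<noteq> 1"
  proof (rule ccontr)
    assume "\<not> ?thesis"
    then have norm1: "norm (\<kappa> i) = 1" if "i < d" for i using that by auto
    from det_non_zero_imp_unit[OF W detW, of "()"] obtain V where V: "V \<in> carrier_mat d d" "V * W = 1\<^sub>m d"
      by (auto simp: Units_def ring_mat_def)
    define T where "T = (\<Sum>i<d. \<Sum>j<d. \<Sum>l<d. norm (V $$ (i, l)) * norm (\<mu> l) ^ j)"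
    have "\<bar>real_of_int ((A ^\<^sub>m n) $$ (i, j))\<bar> \<le> T" if ij: "i < d" "j < d" for n i j
    proof -
      have hA: "?h (A ^\<^sub>m n) \<in> carrier_mat d d" using A by simp
      have "?h (A ^\<^sub>m n) = V * W * ?h (A ^\<^sub>m n)" unfolding V(2) using left_mult_one_mat[OF hA] by simp
      also have "\<dots> = V * mat d d (\<lambda>(i, j). \<kappa> i ^ n * \<mu> i ^ j)"
        unfolding assoc_mult_mat[OF V(1) W hA] WP ..
      finally have eq: "?h (A ^\<^sub>m n) = V * mat d d (\<lambda>(i, j). \<kappa> i ^ n * \<mu> i ^ j)" .
      have "mat d d (\<lambda>(i, j). \<kappa> i ^ n * \<mu> i ^ j) \<in> carrier_mat d d" by simp
      from index_mult_mat_sum[OF V(1) this ij]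
      have entry: "?h (A ^\<^sub>m n) $$ (i, j) = (\<Sum>l<d. V $$ (i, l) * (\<kappa> l ^ n * \<mu> l ^ j))"
        unfolding eq using ij by simp
      have "\<bar>real_of_int ((A ^\<^sub>m n) $$ (i, j))\<bar> = norm (\<Sum>l<d. V $$ (i, l) * (\<kappa> l ^ n * \<mu> l ^ j))"
      proof -
        have "?h (A ^\<^sub>m n) $$ (i, j) = of_int ((A ^\<^sub>m n) $$ (i, j))" using ij A by simp
        with entry show ?thesis by (metis norm_of_int)
      qed
      also have "\<dots> \<le> (\<Sum>l<d. norm (V $$ (i, l)) * norm (\<mu> l) ^ j)"
        by (rule sum_norm_le) (auto simp: norm_mult norm_power norm1)
      also have "\<dots> \<le> (\<Sum>j<d. \<Sum>l<d. norm (V $$ (i, l)) * norm (\<mu> l) ^ j)"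
        using ij by (intro member_le_sum[of j]) (auto intro!: sum_nonneg)
      also have "\<dots> \<le> T"
        unfolding T_def using ij by (intro member_le_sum[of i]) (auto intro!: sum_nonneg)
      finally show ?thesis .
    qed
    from bounded_powers_finite_order[OF A B this] order show False by blast
  qed
  then obtain i0 where i0: "i0 < d" "norm (\<kappa> i0) \<noteq> 1" by blast
  have "(\<Prod>j<d. \<Prod>l<j. norm (\<kappa> j ^ (a + N * k) - \<kappa> l ^ (a + N * k))) = norm (det W)" for k
  proof -
    have "norm (\<Prod>j<d. \<Prod>l<j. \<kappa> j ^ (a + N * k) - \<kappa> l ^ (a + N * k)) =
        norm (det W) * of_int \<bar>det (krylov_mat d (A ^\<^sub>m (a + N * k)))\<bar>"
      unfolding detK[symmetric] by (simp add: norm_mult)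
    then show ?thesis using unit by (simp add: prod_norm)
  qed
  from not_constant_prod_pairs[OF prod1 i0 N _ this] detW show False by simp
qed

theorem theorem1p5:
  fixes d :: nat and M :: "int mat"
  assumes "d \<ge> 2"
    and "M \<in> GL_int d"
    and "infinite_order_mat M"
  shows "\<exists>n0::nat. \<forall>n\<ge>n0. \<not> conjugate_to_companion d (M ^\<^sub>m n)"
proof (rule ccontr)
  assume neg: "\<not> ?thesis"
  then have unbounded: "\<exists>n\<ge>n0. conjugate_to_companion d (M ^\<^sub>m n)" for n0 by blast
  have M: "M \<in> carrier_mat d d" using assms(2) by (simp add: GL_int_def)
  from assms(2) obtain M' where M': "inverts_mat M M'" "inverts_mat M' M"
    by (auto simp: GL_int_def invertible_mat_def)
  have M'c: "M' \<in> carrier_mat d d"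
    using M M' unfolding inverts_mat_def
    by (metis carrier_matD carrier_matI index_mult_mat(3) index_one_mat(3) index_mult_mat(2))
  have M'M: "M' * M = 1\<^sub>m d" using M'(2) M'c by (simp add: inverts_mat_def)
  \<comment> \<open>The choice \<open>m \<ge> 2\<close> makes \<open>1 / m\<close> a non-integer, as
    the exclusion of multiple roots requires.\<close>
  obtain m where m: "m \<ge> 2" "conjugate_to_companion d (M ^\<^sub>m m)" using unbounded by blast
  obtain C P Q where C: "companion_mat d C" and wit: "similar_mat_wit (M ^\<^sub>m m) C P Q"
    using m(2) by (auto simp: conjugate_to_companion_def similar_mat_def)
  from similar_mat_witD2[OF pow_carrier_mat[OF M] wit]
  have PQ: "P * Q = 1\<^sub>m d" "Q * P = 1\<^sub>m d" "M ^\<^sub>m m = P * C * Q" "C \<in> carrier_mat d d"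
    "P \<in> carrier_mat d d" "Q \<in> carrier_mat d d" by auto
  note asc = assoc_mult_mat[of _ d d _ d _ d] and mc = mult_carrier_mat[of _ d d _ d]
  \<comment> \<open>The conjugation taking \<open>M ^\<^sub>m m\<close> to \<open>C\<close> is
    applied to \<open>M\<close> itself, so that \<open>A ^\<^sub>m m\<close> equals
    \<open>C\<close>.\<close>
  define A where "A = Q * M * P"
  have A: "A \<in> carrier_mat d d" using M PQ by (simp add: A_def)
  have wit_A: "similar_mat_wit A M Q P"
    using PQ M A by (intro similar_mat_witI[of _ _ d]) (auto simp: A_def)
  have A_pow: "A ^\<^sub>m k = Q * M ^\<^sub>m k * P" for k by (rule similar_mat_wit_pow_id[OF wit_A])
  have "A ^\<^sub>m m = Q * P * C * (Q * P)"
    unfolding A_pow PQ(3) using PQ(4-6) by (simp add: asc mc)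
  then have A_comp: "companion_mat d (A ^\<^sub>m m)" using PQ(2,4) C by simp
  have "(Q * M' * P) * A = Q * (M' * (P * Q) * M) * P"
    unfolding A_def using PQ(5,6) M M'c by (simp add: asc mc)
  then have inv: "(Q * M' * P) * A = 1\<^sub>m d" using PQ M M'c M'M by simp
  have order: "A ^\<^sub>m k \<noteq> 1\<^sub>m d" if "k > 0" for k
  proof
    assume one: "A ^\<^sub>m k = 1\<^sub>m d"
    have "P * A ^\<^sub>m k * Q = (P * Q) * M ^\<^sub>m k * (P * Q)"
      unfolding A_pow using PQ(5,6) pow_carrier_mat[OF M, of k] by (simp add: asc mc)
    also have "\<dots> = M ^\<^sub>m k" unfolding PQ(1) using M by simp
    finally have "M ^\<^sub>m k = 1\<^sub>m d" using PQ(1,5) by (simp add: one)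
    with assms(3) that M show False by (auto simp: infinite_order_mat_def)
  qed
  have "finite {n. conjugate_to_companion d (A ^\<^sub>m n)}"
    using PQ(5,6) M'c by (intro companion_power_finite[OF A _ inv order assms(1) m(1) A_comp]) auto
  then obtain n0 where n0: "\<And>n. conjugate_to_companion d (A ^\<^sub>m n) \<Longrightarrow> n < n0"
    by (auto simp: finite_nat_set_iff_bounded)
  obtain n where n: "n \<ge> n0" "conjugate_to_companion d (M ^\<^sub>m n)" using unbounded by blast
  have "similar_mat (A ^\<^sub>m n) (M ^\<^sub>m n)"
    using similar_mat_wit_pow[OF wit_A, of n] by (auto simp: similar_mat_def)
  with n(2) have "conjugate_to_companion d (A ^\<^sub>m n)"
    unfolding conjugate_to_companion_def using similar_mat_trans by blast
  with n0 n(1) show False by fastforce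
qed

end
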